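(* Let $N=\begin{pmatrix} m & n \\ p & q \end{pmatrix}$ be a matrix of integers $m,n,p,q\ge 1$ with $\det N>0$, and let $f\in\mathcal B_N$ be any Blaschke product associated to $N$, regarded as a rational map of $\mathbb P^2$. Then $f$ has the same first dynamical degree as the monomial map associated to $N$, namely $$\lambda_1(f)=c_+(N)=\frac{m+q+\sqrt{(m-q)^2+4np}}{2},$$ where $c_+(N)$ is the leading (largest) eigenvalue of $N$.
   Context: $\mathbb D$ is the open unit disc in $\mathbb C$ and $\mathbb P^2$ is the complex projective plane. $\mathcal B_N$ is the set of all maps $$f(z,w)=\left(\theta_1\prod_{i=1}^m\frac{z-a_i}{1-\bar a_i z}\prod_{i=1}^n\frac{w-b_i}{1-\bar b_i w},\ \theta_2\prod_{i=1}^p\frac{z-c_i}{1-\bar c_i z}\prod_{i=1}^q\frac{w-d_i}{1-\bar d_i w}\right)$$ with $|\theta_1|=|\theta_2|=1$ and all zeros $a_i,b_i,c_i,d_i\in\mathbb D$. Such an $f$ is regarded as a rational map $\mathbb P^2\dashrightarrow\mathbb P^2$ through the affine chart $(z,w)\mapsto[z:w:1]$. The monomial map associated to $N$ is $(z,w)\mapsto(z^mw^n,z^pw^q)$. For a rational map $g:\mathbb P^2\dashrightarrow\mathbb P^2$, the algebraic degree $d_{\rm alg}(g)$ is the common degree of three homogeneous polynomials without common factor representing $g$, and the first dynamical degree is $\lambda_1(g)=\lim_{k\to\infty}(d_{\rm alg}(g^k))^{1/k}$, where $g^k$ is the $k$-th iterate as a rational map (this limit always exists). *)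

theory Defs
  imports Complex_Main "Jordan_Normal_Form.Char_Poly"
begin

section \<open>Polynomials in three variables\<close>

text \<open>
  \<open>\<complex>[X, Y, Z]\<close> is rendered as iterated univariate polynomials; \<open>X\<close> is the
  innermost and \<open>Z\<close> the outermost variable, so the coefficient of \<open>X^i Y^j Z^k\<close>
  in \<open>P\<close> is \<open>coeff (coeff (coeff P k) j) i\<close>.
\<close>

type_synonym poly3 = "complex poly poly poly"

definition varX :: poly3 where "varX = [:[:[:0, 1:]:]:]"
definition varY :: poly3 where "varY = [:[:0, 1:]:]"
definition varZ :: poly3 where "varZ = [:0, 1:]"
definition const3 :: "complex \<Rightarrow> poly3" where "const3 c = [:[:[:c:]:]:]"

text \<open>The zero polynomial is homogeneous of every degree.\<close>

definition homogeneous :: "nat \<Rightarrow> poly3 \<Rightarrow> bool" where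
  "homogeneous d P \<longleftrightarrow>
     (\<forall>i j k. coeff (coeff (coeff P k) j) i \<noteq> 0 \<longrightarrow> i + j + k = d)"

text \<open>
  Substitution of \<open>x, y, z\<close> for \<open>X, Y, Z\<close>, in any commutative ring to which the
  coefficients are sent by \<open>\<iota>\<close>: with \<open>\<iota> = id\<close> this is the value at a point of
  \<open>\<complex>^3\<close>, with \<open>\<iota> = const3\<close> it is composition of polynomials.
\<close>

definition eval3 :: "(complex \<Rightarrow> 'a::comm_ring_1) \<Rightarrow> poly3 \<Rightarrow> 'a \<Rightarrow> 'a \<Rightarrow> 'a \<Rightarrow> 'a" where
  "eval3 \<iota> P x y z =
     poly (map_poly (\<lambda>Q. poly (map_poly (\<lambda>R. poly (map_poly \<iota> R) x) Q) y) P) z"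


section \<open>Rational self-maps of the projective plane\<close>

type_synonym triple = "poly3 \<times> poly3 \<times> poly3"

fun hom_triple :: "nat \<Rightarrow> triple \<Rightarrow> bool" where
  "hom_triple d (F0, F1, F2) \<longleftrightarrow>
     homogeneous d F0 \<and> homogeneous d F1 \<and> homogeneous d F2 \<and> (F0, F1, F2) \<noteq> (0, 0, 0)"

text \<open>Equality up to a nonzero factor \<open>b / a\<close> in the field of fractions.\<close>

fun proportional :: "triple \<Rightarrow> triple \<Rightarrow> bool" where
  "proportional (F0, F1, F2) (G0, G1, G2) \<longleftrightarrow>
     (\<exists>a b. a \<noteq> 0 \<and> b \<noteq> 0 \<and> a * F0 = b * G0 \<and> a * F1 = b * G1 \<and> a * F2 = b * G2)"

definition same_map :: "triple \<Rightarrow> triple \<Rightarrow> bool" where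
  "same_map F G \<longleftrightarrow> (\<exists>d. hom_triple d F) \<and> (\<exists>e. hom_triple e G) \<and> proportional F G"

lemma proportional_refl: "proportional F F"
proof (cases F)
  case (fields F0 F1 F2)
  have "(1::poly3) \<noteq> 0" by simp
  then show ?thesis unfolding fields proportional.simps by blast
qed

lemma proportional_sym: "proportional F G \<Longrightarrow> proportional G F"
  by (cases F; cases G) (simp only: proportional.simps, metis)

lemma proportional_trans:
  assumes "proportional F G" "proportional G H"
  shows "proportional F H"
proof -
  obtain F0 F1 F2 G0 G1 G2 H0 H1 H2
    where [simp]: "F = (F0, F1, F2)" "G = (G0, G1, G2)" "H = (H0, H1, H2)"
    by (metis prod_cases3)
  from assms(1) obtain a b where ab: "a \<noteq> 0" "b \<noteq> 0"
    "a * F0 = b * G0" "a * F1 = b * G1" "a * F2 = b * G2" by auto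
  from assms(2) obtain c d where cd: "c \<noteq> 0" "d \<noteq> 0"
    "c * G0 = d * H0" "c * G1 = d * H1" "c * G2 = d * H2" by auto
  have chain: "(c * a) * f = (b * d) * h" if "a * f = b * g" "c * g = d * h" for f g h :: poly3
  proof -
    have "(c * a) * f = c * (a * f)" by (rule mult.assoc)
    also have "\<dots> = b * (c * g)" by (simp only: that(1) mult.left_commute)
    also have "\<dots> = (b * d) * h" by (simp only: that(2) mult.assoc)
    finally show ?thesis .
  qed
  have "c * a \<noteq> 0" "b * d \<noteq> 0" using ab cd by auto
  moreover have "(c * a) * F0 = (b * d) * H0" "(c * a) * F1 = (b * d) * H1"
    "(c * a) * F2 = (b * d) * H2"
    using chain ab cd by blast+
  ultimately have "\<exists>a b. a \<noteq> 0 \<and> b \<noteq> 0 \<and> a * F0 = b * H0 \<and> a * F1 = b * H1 \<and> a * F2 = b * H2"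
    by blast
  then show ?thesis by simp
qed

text \<open>
  A rational map is a class of triples \<open>[F0 : F1 : F2]\<close> of homogeneous polynomials
  of one common degree, not all zero; a common factor is allowed.
\<close>

quotient_type ratmap = triple / partial: same_map
proof (rule part_equivpI)
  have "hom_triple 0 (1, 1, 1)"
    by (simp add: homogeneous_def)
  then show "\<exists>F. same_map F F"
    unfolding same_map_def using proportional_refl by blast
  show "symp same_map"
    unfolding same_map_def by (auto intro!: sympI dest: proportional_sym)
  show "transp same_map"
    unfolding same_map_def by (auto intro!: transpI dest: proportional_trans)
qed

definition represents :: "triple \<Rightarrow> ratmap \<Rightarrow> bool" where
  "represents F g \<longleftrightarrow> (\<exists>d. hom_triple d F) \<and> g = abs_ratmap F"

definition no_common_factor :: "triple \<Rightarrow> bool" where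
  "no_common_factor = (\<lambda>(F0, F1, F2).
     \<forall>D. D dvd F0 \<and> D dvd F1 \<and> D dvd F2 \<longrightarrow> is_unit D)"

definition alg_degree :: "ratmap \<Rightarrow> nat" where
  "alg_degree g = (THE d. \<exists>F. hom_triple d F \<and> represents F g \<and> no_common_factor F)"

definition comp_triple :: "triple \<Rightarrow> triple \<Rightarrow> triple" where
  "comp_triple = (\<lambda>(F0, F1, F2) (G0, G1, G2).
     (eval3 const3 F0 G0 G1 G2, eval3 const3 F1 G0 G1 G2, eval3 const3 F2 G0 G1 G2))"

text \<open>
  The composite \<open>g \<circ> h\<close> is defined unless \<open>h\<close> maps the plane into the indeterminacy
  locus of \<open>g\<close>, i.e. unless all triples for \<open>g\<close> vanish identically on the image of
  \<open>h\<close>. It does not depend on the triples chosen, but a bad choice for \<open>g\<close> (with a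
  common factor that vanishes on the image of \<open>h\<close>) can make the composed triple zero.
\<close>

definition ratmap_comp :: "ratmap \<Rightarrow> ratmap \<Rightarrow> ratmap" where
  "ratmap_comp g h = (THE k. \<exists>F G. represents F g \<and> represents G h \<and>
     comp_triple F G \<noteq> (0, 0, 0) \<and> represents (comp_triple F G) k)"

definition ratmap_id :: ratmap where
  "ratmap_id = abs_ratmap (varX, varY, varZ)"

definition ratmap_iter :: "nat \<Rightarrow> ratmap \<Rightarrow> ratmap" where
  "ratmap_iter k g = (ratmap_comp g ^^ k) ratmap_id"

text \<open>
  The degree sequence is indexed from \<open>k = 0\<close>, where \<open>root 0\<close> is \<open>0\<close> by convention;
  this does not affect the limit.
\<close>

definition degree_growth :: "ratmap \<Rightarrow> nat \<Rightarrow> real" where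
  "degree_growth g k = root k (real (alg_degree (ratmap_iter k g)))"

definition first_dyn_degree :: "ratmap \<Rightarrow> real" where
  "first_dyn_degree g = lim (degree_growth g)"

text \<open>
  \<open>g\<close> is given by the map \<open>\<phi>\<close> in the affine chart \<open>(z, w) \<mapsto> [z : w : 1]\<close>, off a proper
  algebraic subset \<open>{D = 0}\<close> that contains the poles of \<open>\<phi>\<close> (where division by zero gives
  \<open>\<phi>\<close> arbitrary values); in \<open>D\<close>, the inner variable is \<open>z\<close> and the outer one \<open>w\<close>.
\<close>

definition in_chart :: "ratmap \<Rightarrow> (complex \<times> complex \<Rightarrow> complex \<times> complex) \<Rightarrow> bool" where
  "in_chart g \<phi> \<longleftrightarrow>
     (\<exists>F0 F1 F2. represents (F0, F1, F2) g \<and>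
       (\<exists>D :: complex poly poly. D \<noteq> 0 \<and>
         (\<forall>z w. poly (poly D [:w:]) z \<noteq> 0 \<longrightarrow>
            eval3 id F2 z w 1 \<noteq> 0 \<and>
            \<phi> (z, w) = (eval3 id F0 z w 1 / eval3 id F2 z w 1,
                        eval3 id F1 z w 1 / eval3 id F2 z w 1))))"

definition ratmap_of :: "(complex \<times> complex \<Rightarrow> complex \<times> complex) \<Rightarrow> ratmap" where
  "ratmap_of \<phi> = (THE g. in_chart g \<phi>)"


section \<open>Blaschke products and monomial maps\<close>

definition blaschke_factor :: "complex \<Rightarrow> complex \<Rightarrow> complex" where
  "blaschke_factor a z = (z - a) / (1 - cnj a * z)"

definition blaschke_products ::
    "nat \<Rightarrow> nat \<Rightarrow> nat \<Rightarrow> nat \<Rightarrow> (complex \<times> complex \<Rightarrow> complex \<times> complex) set" where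
  "blaschke_products m n p q =
     {f. \<exists>\<theta>1 \<theta>2 a b c d.
        cmod \<theta>1 = 1 \<and> cmod \<theta>2 = 1 \<and>
        (\<forall>i\<in>{1..m}. cmod (a i) < 1) \<and> (\<forall>i\<in>{1..n}. cmod (b i) < 1) \<and>
        (\<forall>i\<in>{1..p}. cmod (c i) < 1) \<and> (\<forall>i\<in>{1..q}. cmod (d i) < 1) \<and>
        f = (\<lambda>(z, w).
          (\<theta>1 * (\<Prod>i=1..m. blaschke_factor (a i) z) * (\<Prod>i=1..n. blaschke_factor (b i) w),
           \<theta>2 * (\<Prod>i=1..p. blaschke_factor (c i) z) * (\<Prod>i=1..q. blaschke_factor (d i) w)))}"

definition monomial_map :: "nat \<Rightarrow> nat \<Rightarrow> nat \<Rightarrow> nat \<Rightarrow> complex \<times> complex \<Rightarrow> complex \<times> complex" where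
  "monomial_map m n p q = (\<lambda>(z, w). (z ^ m * w ^ n, z ^ p * w ^ q))"

definition largest_eigenvalue :: "int mat \<Rightarrow> real" where
  "largest_eigenvalue N = Max {x. eigenvalue (map_mat real_of_int N) x}"

end

theory Submission
  imports Defs "HOL-Computational_Algebra.Polynomial_Factorial" "HOL-Computational_Algebra.Field_as_Ring"
begin

text \<open>
  Write the \<open>k\<close>-th iterate of \<open>f\<close> as \<open>(P/Q, U/V)\<close>, where substitution into the defining
  products gives the fractions of the next iterate. If \<open>P, Q\<close> are homogeneous of degree \<open>r\<close> and
  \<open>U, V\<close> of degree \<open>s\<close>, the next pair of degrees is \<open>N (r, s)\<close>. So \<open>(r, s) = N^k (1, 1)\<close>, and the
  homogeneous triple \<open>(P V, U Q, Q V)\<close> shows that the degree of the iterate is at most \<open>r + s\<close>.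

  The whole difficulty is a lower bound, since common factors might accumulate in the triple. They
  cannot cancel more than \<open>s\<close> degrees, because \<open>P\<close> and \<open>Q\<close> never share a zero on the lines
  \<open>{(x, y, z) | z \<in> \<complex>}\<close> with \<open>|x| = |y| = 1\<close>. Indeed a Blaschke factor maps the disc, the circle
  and the exterior of the disc to themselves; hence \<open>f\<close> preserves the products of two discs, of two
  circles and of two exteriors, and at a point with \<open>|x| = |y|\<close> the three cases \<open>|x| < |z|\<close>,
  \<open>|x| = |z|\<close>, \<open>|x| > |z|\<close> give \<open>|P| < |Q|\<close>, \<open>|P| = |Q| \<noteq> 0\<close>, \<open>|P| > |Q|\<close> (\<open>fractions_norm\<close>). On such
  a line \<open>P/Q\<close> is thus in lowest terms, and \<open>Q\<close> keeps its full degree \<open>r\<close> because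
  \<open>Q(0, 0, 1) \<noteq> 0\<close>. A triple \<open>(F\<^sub>0, F\<^sub>1, F\<^sub>2)\<close> for the iterate satisfies
  \<open>F\<^sub>0 Q = P F\<^sub>2\<close>, so on a line where \<open>F\<^sub>2\<close> does not vanish identically \<open>Q\<close> divides \<open>F\<^sub>2\<close> and the degree
  of the triple is at least \<open>r\<close> (\<open>degree_lower_bound\<close>).

  The degree of the \<open>k\<close>-th iterate therefore lies between \<open>r\<close> and \<open>r + s\<close>. As the leading
  eigenvector of \<open>N\<close> has positive entries, both bounds are comparable to the \<open>k\<close>-th power of the
  leading eigenvalue, whose \<open>k\<close>-th root is the limit. The monomial map is the Blaschke product
  all of whose zeros are \<open>0\<close>.

  Some algebra is needed to make degrees of rational maps computable. Homogeneity is turned into a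
  single equation through the ring homomorphism \<open>grade\<close>, unique factorisation gives every
  rational map a reduced triple of least degree, and a homogeneous polynomial is determined by its
  values in the affine chart.
\<close>

section \<open>Ring homomorphisms on polynomials in three variables\<close>

abbreviation monom3 :: "complex \<Rightarrow> nat \<Rightarrow> nat \<Rightarrow> nat \<Rightarrow> poly3" where
  "monom3 c i j k \<equiv> monom (monom (monom c i) j) k"

lemma poly_monom_induct:
  fixes p :: "'a::comm_ring_1 poly"
  assumes "\<And>p q. Q p \<Longrightarrow> Q q \<Longrightarrow> Q (p + q)" and "\<And>c i. Q (monom c i)"
  shows "Q p"
proof -
  have "Q 0" using assms(2)[of 0 0] by simp
  have "Q (\<Sum>i\<in>I. monom (coeff p i) i)" if "finite I" for I
    using that by induction (use assms \<open>Q 0\<close> in auto)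
  then show ?thesis
    using poly_as_sum_of_monoms[of p] by (metis finite_atMost)
qed

lemma poly3_induct:
  assumes add: "\<And>P P'. Q P \<Longrightarrow> Q P' \<Longrightarrow> Q (P + P')" and mon: "\<And>c i j k. Q (monom3 c i j k)"
  shows "Q P"
proof (rule poly_monom_induct[of Q], fact add)
  fix A k
  show "Q (monom A k)"
  proof (rule poly_monom_induct[of "\<lambda>A. Q (monom A k)"])
    show "Q (monom (p + q) k)" if "Q (monom p k)" "Q (monom q k)" for p q
      using add[OF that] by (simp add: add_monom)
    fix B j
    show "Q (monom (monom B j) k)"
      by (rule poly_monom_induct[of "\<lambda>B. Q (monom (monom B j) k)"])
         (use add mon in \<open>auto simp flip: add_monom\<close>)
  qed
qed

lemmas comm_ring_hom_unfold =
  comm_ring_hom_def Ring_Hom.ring_hom_def semiring_hom_def comm_semiring_hom_def comm_monoid_add_hom_def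
  monoid_add_hom_def zero_hom_def semigroup_add_hom_def plus_hom_def
  monoid_mult_hom_def one_hom_def semigroup_mult_hom_def times_hom_def

lemma comm_ring_homI:
  fixes h :: "'a::comm_ring_1 \<Rightarrow> 'b::comm_ring_1"
  assumes "h 1 = 1" "\<And>x y. h (x + y) = h x + h y" "\<And>x y. h (x * y) = h x * h y"
  shows "comm_ring_hom h"
proof -
  have "h 0 = 0" using assms(2)[of 0 0] by simp
  then show ?thesis using assms by (simp add: comm_ring_hom_unfold)
qed

lemma comm_ring_hom_simps:
  fixes h :: "'a::comm_ring_1 \<Rightarrow> 'b::comm_ring_1"
  assumes "comm_ring_hom h"
  shows "h 0 = 0" "h 1 = 1" "h (x + y) = h x + h y" "h (x * y) = h x * h y"
    "h (x - y) = h x - h y" "h (x ^ k) = h x ^ k" "h (\<Prod>i\<in>I. g i) = (\<Prod>i\<in>I. h (g i))"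
proof -
  have h: "h 0 = 0" "h 1 = 1" "h (x + y) = h x + h y" "h (x * y) = h x * h y" for x y
    using assms by (simp_all add: comm_ring_hom_unfold)
  have "h (x - y) + h y = h x" by (simp flip: h(3))
  then show "h (x - y) = h x - h y" by (simp add: eq_diff_eq)
  show "h (x ^ k) = h x ^ k" by (induction k) (simp_all add: h)
  show "h (\<Prod>i\<in>I. g i) = (\<Prod>i\<in>I. h (g i))"
    by (induction I rule: infinite_finite_induct) (simp_all add: h)
qed (use assms in \<open>simp_all add: comm_ring_hom_unfold\<close>)

lemma map_poly_pCons_ring_hom:
  "comm_ring_hom h \<Longrightarrow> map_poly h (pCons c p) = pCons (h c) (map_poly h p)"
  by (rule poly_eqI) (simp add: coeff_map_poly coeff_pCons comm_ring_hom_simps split: nat.split)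

lemma comm_ring_hom_eval_poly:
  assumes "comm_ring_hom h"
  shows "comm_ring_hom (\<lambda>p. poly (map_poly h p) x)"
proof -
  note h = comm_ring_hom_simps[OF assms]
  have add: "map_poly h (p + q) = map_poly h p + map_poly h q" for p q
    by (rule poly_eqI) (simp add: coeff_map_poly h)
  have "map_poly h (p * q) = map_poly h p * map_poly h q" for p q
  proof (induction p)
    case (pCons a p)
    have "map_poly h (Polynomial.smult a q) = Polynomial.smult (h a) (map_poly h q)"
      by (rule poly_eqI) (simp add: coeff_map_poly h)
    with pCons show ?case
      by (simp add: add map_poly_pCons_ring_hom[OF assms] h)
  qed simp
  with add show ?thesis
    by (intro comm_ring_homI) (simp_all add: h)
qed

lemma comm_ring_hom_eval3:
  assumes "comm_ring_hom \<iota>"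
  shows "comm_ring_hom (\<lambda>P. eval3 \<iota> P x y z)"
  unfolding eval3_def by (intro comm_ring_hom_eval_poly assms)

lemma monom3_vars: "const3 c = monom3 c 0 0 0" "varX = monom3 1 1 0 0" "varY = monom3 1 0 1 0" "varZ = monom3 1 0 0 1"
  by (simp_all add: const3_def varX_def varY_def varZ_def monom_0 monom_Suc one_pCons)

lemma monom3_altdef: "monom3 c i j k = const3 c * varX ^ i * varY ^ j * varZ ^ k"
  by (simp add: monom3_vars monom_power mult_monom)

lemma eval3_monom3:
  assumes "comm_ring_hom \<iota>"
  shows "eval3 \<iota> (monom3 c i j k) x y z = \<iota> c * x ^ i * y ^ j * z ^ k"
  by (simp add: eval3_def map_poly_monom poly_monom assms comm_ring_hom_eval_poly comm_ring_hom_simps)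

lemma eval3_const3: "comm_ring_hom \<iota> \<Longrightarrow> eval3 \<iota> (const3 c) x y z = \<iota> c"
  using eval3_monom3[of \<iota> c 0 0 0 x y z] by (simp add: const3_def monom_0)

lemma eval3_varX: "comm_ring_hom \<iota> \<Longrightarrow> eval3 \<iota> varX x y z = x"
  using eval3_monom3[of \<iota> 1 1 0 0 x y z]
  by (simp add: varX_def monom_0 comm_ring_hom_simps monom_Suc one_pCons)

lemma eval3_varY: "comm_ring_hom \<iota> \<Longrightarrow> eval3 \<iota> varY x y z = y"
  using eval3_monom3[of \<iota> 1 0 1 0 x y z]
  by (simp add: varY_def monom_0 comm_ring_hom_simps monom_Suc one_pCons)

lemma eval3_varZ: "comm_ring_hom \<iota> \<Longrightarrow> eval3 \<iota> varZ x y z = z"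
  using eval3_monom3[of \<iota> 1 0 0 1 x y z]
  by (simp add: varZ_def monom_0 comm_ring_hom_simps monom_Suc one_pCons)

lemmas eval3_gens = eval3_const3 eval3_varX eval3_varY eval3_varZ

lemma comm_ring_hom_const3: "comm_ring_hom const3"
  by (rule comm_ring_homI) (simp_all add: const3_def one_pCons mult.commute)

lemma comm_ring_hom_id: "comm_ring_hom id"
  by (rule comm_ring_homI) auto

lemma comm_ring_hom_comp: "comm_ring_hom g \<Longrightarrow> comm_ring_hom h \<Longrightarrow> comm_ring_hom (\<lambda>x. g (h x))"
  by (rule comm_ring_homI) (simp_all add: comm_ring_hom_simps)

text \<open>
  The universal property of the polynomial ring: the monomials generate it additively, and a
  homomorphism is determined on them by its values at the constants and the variables. Most
  identities about substitution below are instances.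
\<close>

lemma comm_ring_hom_eq_eval3:
  fixes h :: "poly3 \<Rightarrow> 'a::comm_ring_1"
  assumes "comm_ring_hom h"
  shows "h P = eval3 (\<lambda>c. h (const3 c)) P (h varX) (h varY) (h varZ)"
proof -
  have \<iota>: "comm_ring_hom (\<lambda>c. h (const3 c))"
    by (intro comm_ring_hom_comp[OF assms] comm_ring_hom_const3)
  note e = comm_ring_hom_eval3[OF \<iota>]
  show ?thesis
  proof (induction P rule: poly3_induct)
    case (2 c i j k)
    show ?case by (subst eval3_monom3[OF \<iota>]) (simp add: monom3_altdef comm_ring_hom_simps[OF assms])
  qed (simp add: comm_ring_hom_simps[OF assms] comm_ring_hom_simps[OF e])
qed

lemma eval3_eval3:
  assumes "comm_ring_hom \<iota>"
  shows "eval3 \<iota> (eval3 const3 F G0 G1 G2) x y z =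
    eval3 \<iota> F (eval3 \<iota> G0 x y z) (eval3 \<iota> G1 x y z) (eval3 \<iota> G2 x y z)"
  using comm_ring_hom_eq_eval3[OF comm_ring_hom_comp[OF comm_ring_hom_eval3[OF assms, of x y z]
      comm_ring_hom_eval3[OF comm_ring_hom_const3, of G0 G1 G2]], of F]
  by (simp add: eval3_gens assms comm_ring_hom_const3)

section \<open>Homogeneous polynomials\<close>

text \<open>
  \<open>P(TX, TY, TZ)\<close> as a polynomial in \<open>T\<close>; the coefficient of \<open>T^e\<close> is the part of \<open>P\<close> of degree \<open>e\<close>.
\<close>

definition grade :: "poly3 \<Rightarrow> poly3 poly" where
  "grade P = eval3 (\<lambda>c. [:const3 c:]) P (monom varX 1) (monom varY 1) (monom varZ 1)"

lemma comm_ring_hom_const_const3: "comm_ring_hom (\<lambda>c. [:const3 c:])"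
  by (rule comm_ring_homI) (simp_all add: const3_def one_pCons mult.commute)

lemma comm_ring_hom_grade: "comm_ring_hom grade"
  unfolding grade_def by (intro comm_ring_hom_eval3 comm_ring_hom_const_const3)

lemmas grade_simps = comm_ring_hom_simps[OF comm_ring_hom_grade]

lemma grade_monom3: "grade (monom3 c i j k) = monom (monom3 c i j k) (i + j + k)"
  unfolding grade_def
  by (subst eval3_monom3[OF comm_ring_hom_const_const3])
     (simp add: monom_power mult_monom monom3_altdef smult_monom mult.assoc)

lemma coeff_grade:
  "coeff (coeff (coeff (coeff (grade P) e) k) j) i =
     (if i + j + k = e then coeff (coeff (coeff P k) j) i else 0)"
  by (induction P rule: poly3_induct) (auto simp: grade_simps grade_monom3)

text \<open>
  The coefficient \<open>C\<close> is automatically \<open>P\<close>, but in \<open>homogeneous_factor\<close> it is not known in advance.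
\<close>

lemma homogeneous_if_grade_monom:
  assumes "grade P = monom C d"
  shows "homogeneous d P"
proof -
  have "coeff (coeff (coeff P k) j) i = 0" if "i + j + k \<noteq> d" for i j k
    using coeff_grade[of P "i + j + k" k j i] that assms by auto
  then show ?thesis
    unfolding homogeneous_def by blast
qed

text \<open>
  Since \<open>grade\<close> is a ring homomorphism, this reduces closure properties of homogeneous polynomials
  to identities between monomials in \<open>T\<close>.
\<close>

lemma homogeneous_iff_grade: "homogeneous d P \<longleftrightarrow> grade P = monom P d"
proof
  assume "homogeneous d P"
  then show "grade P = monom P d"
    by (intro poly_eqI) (auto simp: coeff_grade homogeneous_def)
qed (rule homogeneous_if_grade_monom)

lemma homogeneous_mult: "homogeneous d P \<Longrightarrow> homogeneous e Q \<Longrightarrow> homogeneous (d + e) (P * Q)"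
  by (simp add: homogeneous_iff_grade grade_simps mult_monom)

lemma homogeneous_diff: "homogeneous d P \<Longrightarrow> homogeneous d Q \<Longrightarrow> homogeneous d (P - Q)"
  by (simp add: homogeneous_iff_grade grade_simps diff_monom)

lemma homogeneous_1: "homogeneous 0 1"
  by (simp add: homogeneous_iff_grade grade_simps monom_0 pCons_one)

lemma homogeneous_prod:
  "(\<And>i. i \<in> I \<Longrightarrow> homogeneous (d i) (P i)) \<Longrightarrow> homogeneous (\<Sum>i\<in>I. d i) (\<Prod>i\<in>I. P i)"
  by (induction I rule: infinite_finite_induct) (auto intro: homogeneous_mult simp: homogeneous_1)

lemma homogeneous_vars: "homogeneous 0 (const3 c)" "homogeneous 1 varX" "homogeneous 1 varY" "homogeneous 1 varZ"
  by (simp_all add: homogeneous_iff_grade grade_def eval3_gens comm_ring_hom_const_const3 monom_0)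

lemma homogeneous_0: "homogeneous d 0"
  by (simp add: homogeneous_def)

lemma homogeneous_degree_unique:
  assumes "homogeneous d P" "homogeneous e P" "P \<noteq> 0"
  shows "d = e"
  using assms by (metis homogeneous_iff_grade degree_monom_eq)

text \<open>
  Both sides are homomorphisms in \<open>P\<close>: evaluation of \<open>P(TX, TY, TZ)\<close> at \<open>T = t\<close>.
\<close>

lemma eval3_scale_grade:
  assumes "comm_ring_hom \<iota>"
  shows "poly (map_poly (\<lambda>P. eval3 \<iota> P x y z) (grade P)) t = eval3 \<iota> P (t * x) (t * y) (t * z)"
proof -
  note e = comm_ring_hom_eval3[OF assms, of x y z]
  have g: "grade (const3 c) = [:const3 c:]" "grade varX = monom varX 1"
    "grade varY = monom varY 1" "grade varZ = monom varZ 1" for c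
    by (simp_all add: grade_def eval3_gens comm_ring_hom_const_const3)
  show ?thesis
    using comm_ring_hom_eq_eval3[OF comm_ring_hom_comp[OF comm_ring_hom_eval_poly[OF
       e, of t] comm_ring_hom_grade], of P]
    by (simp add: g eval3_gens assms poly_monom mult.commute map_poly_monom comm_ring_hom_simps[OF e] flip: monom_0)
qed

lemma eval3_homogeneous:
  assumes "homogeneous d P" "comm_ring_hom \<iota>"
  shows "eval3 \<iota> P (t * x) (t * y) (t * z) = t ^ d * eval3 \<iota> P x y z"
proof -
  note e = comm_ring_hom_eval3[OF assms(2), of x y z]
  show ?thesis
    using assms(1) eval3_scale_grade[OF assms(2), of x y z P t]
    by (simp add: homogeneous_iff_grade poly_monom mult.commute map_poly_monom comm_ring_hom_simps[OF e])
qed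

text \<open>
  Up to the factor \<open>T^d\<close>, \<open>grade\<close> leaves each of the \<open>G\<close> unchanged; homogeneity of \<open>F\<close> pulls this factor out
  as \<open>T^(d * e)\<close>.
\<close>

lemma homogeneous_comp:
  assumes "homogeneous e F" "homogeneous d G0" "homogeneous d G1" "homogeneous d G2"
  shows "homogeneous (d * e) (eval3 const3 F G0 G1 G2)"
proof -
  have m: "monom P d = monom 1 d * [:P:]" for P :: poly3
    by (simp add: mult_monom flip: monom_0)
  have "grade (eval3 const3 F G0 G1 G2)
     = eval3 (\<lambda>c. [:const3 c:]) F (monom G0 d) (monom G1 d) (monom G2 d)"
    using assms unfolding homogeneous_iff_grade
    unfolding grade_def by (subst eval3_eval3[OF comm_ring_hom_const_const3]) simp
  also have "\<dots> = monom 1 d ^ e * eval3 (\<lambda>c. [:const3 c:]) F [:G0:] [:G1:] [:G2:]"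
    by (subst (1 2 3) m) (rule eval3_homogeneous[OF assms(1) comm_ring_hom_const_const3])
  also have "eval3 (\<lambda>c. [:const3 c:]) F [:G0:] [:G1:] [:G2:] = [:eval3 const3 F G0 G1 G2:]"
  proof -
    have "comm_ring_hom (\<lambda>P::poly3. [:P:])" by (rule comm_ring_homI) (simp_all add: one_pCons)
    from comm_ring_hom_eq_eval3[OF comm_ring_hom_comp[OF this comm_ring_hom_eval3[OF comm_ring_hom_const3, of G0 G1 G2]], of F]
    show ?thesis by (simp add: eval3_gens comm_ring_hom_const3)
  qed
  finally show ?thesis
    by (simp add: homogeneous_iff_grade monom_power mult_monom mult.commute smult_monom)
qed

text \<open>
  The degree and the order of vanishing at \<open>0\<close> are both additive, and they agree only for monomials.
\<close>

lemma monomial_factor: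
  fixes p q :: "'a::idom poly"
  assumes "p * q = monom c d" "c \<noteq> 0"
  shows "\<exists>a a'. p = monom a a'"
proof -
  have nz: "p * q \<noteq> 0" using assms by simp
  then have "p \<noteq> 0" "q \<noteq> 0" by auto
  have "order 0 p + order 0 q = d"
    using order_mult[OF nz, of 0] assms by (simp add: order_0_monom)
  moreover have "degree p + degree q = d"
    using degree_mult_eq[OF \<open>p \<noteq> 0\<close> \<open>q \<noteq> 0\<close>] assms by (simp add: degree_monom_eq)
  moreover have "order 0 p \<le> degree p" "order 0 q \<le> degree q"
    using \<open>p \<noteq> 0\<close> \<open>q \<noteq> 0\<close> by (auto intro: order_degree)
  ultimately have "order 0 p = degree p" by linarith
  then have "[:0, 1:] ^ degree p dvd p"
    using order_1[of 0 p] by simp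
  then obtain r where r: "p = [:0, 1:] ^ degree p * r" ..
  with \<open>p \<noteq> 0\<close> have "r \<noteq> 0" by auto
  then have "degree p = degree p + degree r"
    by (subst r) (simp add: degree_mult_eq degree_power_eq)
  then have "degree r = 0" by simp
  then obtain a where "r = [:a:]" by (rule degree_eq_zeroE)
  then have "p = monom a (degree p)"
    using r by (simp add: monom_altdef mult.commute)
  then show ?thesis by blast
qed

text \<open>
  Factors of the monomial \<open>grade (P * Q)\<close> are monomials.
\<close>

lemma homogeneous_factor:
  assumes "homogeneous d (P * Q)" "P * Q \<noteq> 0"
  shows "\<exists>a b. homogeneous a P \<and> homogeneous b Q \<and> a + b = d"
proof -
  have eq: "grade P * grade Q = monom (P * Q) d"
    using assms(1) by (simp add: homogeneous_iff_grade grade_simps)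
  obtain a C where "grade P = monom C a"
    using monomial_factor[OF eq assms(2)] by blast
  moreover obtain b C' where "grade Q = monom C' b"
    using monomial_factor[of "grade Q" "grade P"] eq assms(2) by (metis mult.commute)
  ultimately have *: "homogeneous a P" "homogeneous b Q"
    by (auto intro: homogeneous_if_grade_monom)
  then show ?thesis
    using homogeneous_mult homogeneous_degree_unique assms by blast
qed

lemma homogeneous_0_is_unit:
  assumes "homogeneous 0 D" "D \<noteq> 0"
  shows "is_unit D"
proof -
  define c where "c = coeff (coeff (coeff D 0) 0) 0"
  have D: "D = const3 c"
    using assms(1) unfolding monom3_vars
    by (intro poly_eqI) (auto simp: homogeneous_def c_def)
  with assms(2) have "c \<noteq> 0" by (auto simp: const3_def)
  then have "const3 c * const3 (1 / c) = 1"
    by (simp add: const3_def one_pCons)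
  then show ?thesis unfolding D by (metis dvd_triv_left)
qed

section \<open>Triples and the rational maps they represent\<close>

text \<open>
  For nonzero triples, proportionality amounts to the vanishing of the \<open>2 \<times> 2\<close> minors. This vanishing persists under
  substitution even when the factors of proportionality become zero.
\<close>

lemma proportional_cross:
  assumes "proportional (F0, F1, F2) (G0, G1, G2)"
  shows "F0 * G1 = F1 * G0" "F0 * G2 = F2 * G0" "F1 * G2 = F2 * G1"
proof -
  obtain a b where ab: "a \<noteq> 0" "b \<noteq> 0" "a * F0 = b * G0" "a * F1 = b * G1" "a * F2 = b * G2"
    using assms by auto
  have *: "F * G' = F' * G" if "a * F = b * G" "a * F' = b * G'" for F F' G G'
  proof -
    have "a * b * (F * G') = (a * F) * (b * G')" by (simp only: ac_simps)
    also have "\<dots> = a * b * (F' * G)" unfolding that(1) that(2)[symmetric] by (simp only: ac_simps)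
    finally show ?thesis using ab(1,2) by simp
  qed
  show "F0 * G1 = F1 * G0" "F0 * G2 = F2 * G0" "F1 * G2 = F2 * G1"
    using * ab by blast+
qed

lemma proportional_if_cross:
  assumes "F0 * G1 = F1 * G0" "F0 * G2 = F2 * G0" "F1 * G2 = F2 * G1"
    and "(F0, F1, F2) \<noteq> (0, 0, 0)" "(G0, G1, G2) \<noteq> (0, 0, 0)"
  shows "proportional (F0, F1, F2) (G0, G1, G2)"
proof -
  consider "F0 \<noteq> 0" | "F1 \<noteq> 0" | "F2 \<noteq> 0" using assms(4) by auto
  then show ?thesis
  proof cases
    case 1
    then have "G0 \<noteq> 0" using assms by auto
    with 1 show ?thesis
      unfolding proportional.simps
      by (intro exI[of _ G0] exI[of _ F0]) (use assms in \<open>simp add: mult.commute\<close>)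
  next
    case 2
    then have "G1 \<noteq> 0" using assms by (metis mult_eq_0_iff)
    with 2 show ?thesis
      unfolding proportional.simps
      by (intro exI[of _ G1] exI[of _ F1]) (use assms in \<open>simp add: mult.commute\<close>)
  next
    case 3
    then have "G2 \<noteq> 0" using assms by (metis mult_eq_0_iff)
    with 3 show ?thesis
      unfolding proportional.simps
      by (intro exI[of _ G2] exI[of _ F2]) (use assms in \<open>simp add: mult.commute\<close>)
  qed
qed

lemma represents_abs_ratmap: "hom_triple d F \<Longrightarrow> represents F (abs_ratmap F)"
  by (auto simp: represents_def)

lemma abs_ratmap_eq_iff:
  assumes "hom_triple d F" "hom_triple e G"
  shows "abs_ratmap F = abs_ratmap G \<longleftrightarrow> proportional F G"
  using Quotient_rel[OF Quotient_ratmap, of F G] assms proportional_refl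
  by (auto simp: same_map_def)

lemma represents_proportional: "represents F g \<Longrightarrow> represents G g \<Longrightarrow> proportional F G"
  unfolding represents_def using abs_ratmap_eq_iff by metis

lemma represents_if_proportional:
  "represents F g \<Longrightarrow> proportional F G \<Longrightarrow> hom_triple e G \<Longrightarrow> represents G g"
  unfolding represents_def using abs_ratmap_eq_iff by metis

section \<open>The algebraic degree\<close>

text \<open>
  If \<open>a F = b G\<close> with \<open>a, b\<close> coprime, then \<open>b\<close> divides all entries of \<open>F\<close> and so is a unit.
\<close>

lemma reduced_triple_divides:
  assumes "no_common_factor (F0, F1, F2)" "proportional (F0, F1, F2) (G0, G1, G2)"
  shows "\<exists>c. c \<noteq> 0 \<and> G0 = c * F0 \<and> G1 = c * F1 \<and> G2 = c * F2"
proof -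
  obtain a b where ab: "a \<noteq> 0" "b \<noteq> 0" "a * F0 = b * G0" "a * F1 = b * G1" "a * F2 = b * G2"
    using assms(2) by auto
  define g where "g = gcd a b"
  have "g \<noteq> 0" using ab by (simp add: g_def)
  then obtain a' b' where a'b': "a = a' * g" "b = b' * g" "coprime a' b'"
    using gcd_coprime_exists[of a b] g_def by metis
  have eq: "a' * F = b' * G" if "a * F = b * G" for F G
  proof -
    have "g * (a' * F) = g * (b' * G)" using that by (simp add: a'b' ac_simps)
    then show ?thesis using \<open>g \<noteq> 0\<close> by simp
  qed
  have "b' dvd F" if "a * F = b * G" for F G
    using eq[OF that] a'b'(3) by (metis coprime_commute coprime_dvd_mult_right_iff dvd_triv_left)
  then have "is_unit b'"
    using assms(1) ab by (auto simp: no_common_factor_def)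
  then obtain v where v: "b' * v = 1" by (metis dvdE)
  have G: "G = (v * a') * F" if "a * F = b * G" for F G
  proof -
    have "(v * a') * F = v * (b' * G)" using eq[OF that] by (simp add: mult.assoc)
    also have "\<dots> = (b' * v) * G" by (simp only: ac_simps)
    finally show ?thesis by (simp add: v)
  qed
  have "v * a' \<noteq> 0" using v a'b'(1) ab(1) by auto
  then show ?thesis using G ab by blast
qed

text \<open>
  The degree of \<open>D\<close> is determined by a nonzero entry; zero entries are homogeneous of every degree and
  fit with it.
\<close>

lemma hom_triple_factor:
  assumes G: "hom_triple e G" and "G = (D * H0, D * H1, D * H2)"
  shows "\<exists>a b. homogeneous a D \<and> hom_triple b (H0, H1, H2) \<and> a + b = e"
proof -
  have hom: "homogeneous e (D * H0)" "homogeneous e (D * H1)" "homogeneous e (D * H2)"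
    and nz: "(D * H0, D * H1, D * H2) \<noteq> (0, 0, 0)"
    using assms by auto
  have "D \<noteq> 0" using nz by auto
  have *: "H = 0 \<or> (\<exists>a b. homogeneous a D \<and> homogeneous b H \<and> a + b = e)"
    if "homogeneous e (D * H)" for H
    using homogeneous_factor[OF that] \<open>D \<noteq> 0\<close> by auto
  obtain a b where ab: "homogeneous a D" "a + b = e"
    using *[OF hom(1)] *[OF hom(2)] *[OF hom(3)] nz by auto
  have "homogeneous b H" if "homogeneous e (D * H)" for H
    using *[OF that] ab homogeneous_degree_unique[OF _ _ \<open>D \<noteq> 0\<close>] homogeneous_0
    by (metis add_left_cancel)
  then show ?thesis using ab hom nz by auto
qed

text \<open>
  A proportional homogeneous triple of least degree is reduced: a common factor is homogeneous, and
  dividing by it lowers the degree unless the factor is constant.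
\<close>

lemma reduced_triple_exists:
  assumes "hom_triple d F"
  shows "\<exists>e G. hom_triple e G \<and> proportional F G \<and> no_common_factor G"
proof -
  define A where "A = (\<lambda>e. \<exists>G. hom_triple e G \<and> proportional F G)"
  have "A d" using assms proportional_refl unfolding A_def by blast
  define e where "e = (LEAST e. A e)"
  have "A e" and least: "\<And>b. A b \<Longrightarrow> e \<le> b"
    unfolding e_def using \<open>A d\<close> by (auto intro: LeastI Least_le)
  then obtain G where G: "hom_triple e G" "proportional F G" unfolding A_def by blast
  obtain G0 G1 G2 where [simp]: "G = (G0, G1, G2)" by (cases G)
  have "is_unit D" if D: "D dvd G0" "D dvd G1" "D dvd G2" for D
  proof -
    from D obtain H0 H1 H2 where H: "G0 = D * H0" "G1 = D * H1" "G2 = D * H2" by (auto elim!: dvdE)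
    then obtain a b where ab: "homogeneous a D" "hom_triple b (H0, H1, H2)" "a + b = e"
      using hom_triple_factor[OF G(1), of D H0 H1 H2] by auto
    have "D \<noteq> 0" using G(1) H by auto
    have "proportional G (H0, H1, H2)"
      using \<open>D \<noteq> 0\<close> unfolding \<open>G = _\<close> proportional.simps H
      by (intro exI[of _ 1] exI[of _ D]) simp
    then have "A b" using ab(2) G(2) proportional_trans unfolding A_def by blast
    then have "a = 0" using least[of b] ab(3) by simp
    then show ?thesis using homogeneous_0_is_unit ab(1) \<open>D \<noteq> 0\<close> by simp
  qed
  then have "no_common_factor G" by (auto simp: no_common_factor_def)
  then show ?thesis using G by blast
qed

lemma reduced_triple_degree_le:
  assumes "hom_triple d F" "no_common_factor F" "hom_triple e G" "proportional F G"
  shows "d \<le> e"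
proof -
  obtain F0 F1 F2 where F: "F = (F0, F1, F2)" by (cases F)
  obtain G0 G1 G2 where G: "G = (G0, G1, G2)" by (cases G)
  obtain c where c: "c \<noteq> 0" "G0 = c * F0" "G1 = c * F1" "G2 = c * F2"
    using reduced_triple_divides assms(2,4) unfolding F G by blast
  obtain a b where "hom_triple b F" "a + b = e"
    using hom_triple_factor[OF assms(3), of c F0 F1 F2] c F G by auto
  moreover have "b = d"
    using \<open>hom_triple b F\<close> assms(1) homogeneous_degree_unique unfolding F by auto
  ultimately show ?thesis by simp
qed

text \<open>
  By \<open>reduced_triple_degree_le\<close> all reduced triples of a map have the same degree, so that the
  definite description in \<open>alg_degree\<close> denotes it, and no triple of the map has a smaller one.
\<close>

lemma alg_degree_reduced:
  assumes "represents F g"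
  shows "\<exists>G. hom_triple (alg_degree g) G \<and> represents G g \<and> no_common_factor G"
    and "hom_triple e F \<Longrightarrow> alg_degree g \<le> e"
proof -
  obtain d where "hom_triple d F" using assms by (auto simp: represents_def)
  then obtain e' G where G: "hom_triple e' G" "proportional F G" "no_common_factor G"
    using reduced_triple_exists by blast
  have G': "represents G g" using represents_if_proportional[OF assms G(2,1)] .
  have "\<exists>!d. \<exists>F. hom_triple d F \<and> represents F g \<and> no_common_factor F"
    using G G' reduced_triple_degree_le represents_proportional
    by (intro ex1I[of _ e']) (blast, meson le_antisym)
  from theI'[OF this]
  show *: "\<exists>G. hom_triple (alg_degree g) G \<and> represents G g \<and> no_common_factor G"
    unfolding alg_degree_def .
  show "alg_degree g \<le> e" if "hom_triple e F"
    using * that assms reduced_triple_degree_le represents_proportional by blast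
qed

section \<open>Composition\<close>

lemma hom_triple_comp_triple:
  assumes "hom_triple d F" "hom_triple e G" "comp_triple F G \<noteq> (0, 0, 0)"
  shows "hom_triple (e * d) (comp_triple F G)"
  using assms by (cases F; cases G) (auto simp: comp_triple_def intro: homogeneous_comp)

text \<open>
  If \<open>c G = c' G'\<close> and \<open>F\<close> is homogeneous of degree \<open>d\<close>, then \<open>c^d F(G) = c'^d F(G')\<close>; so \<open>G\<close> may be
  replaced by \<open>G'\<close>. The minors of \<open>F\<close> and \<open>F'\<close> vanish, hence also after substitution of \<open>G'\<close>. This
  avoids the composite \<open>F(G')\<close> of the factors of proportionality of \<open>F\<close> and \<open>F'\<close>, which may be zero.
\<close>

lemma comp_triple_cong:
  assumes F: "hom_triple d F" "proportional F F'" and G: "proportional G G'"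
    and nz: "comp_triple F G \<noteq> (0, 0, 0)" "comp_triple F' G' \<noteq> (0, 0, 0)"
  shows "proportional (comp_triple F G) (comp_triple F' G')"
proof -
  obtain F0 F1 F2 where F': "F = (F0, F1, F2)" by (cases F)
  obtain F0' F1' F2' where F'': "F' = (F0', F1', F2')" by (cases F')
  obtain G0 G1 G2 where G': "G = (G0, G1, G2)" by (cases G)
  obtain G0' G1' G2' where G'': "G' = (G0', G1', G2')" by (cases G')
  obtain c c' where c: "c \<noteq> 0" "c' \<noteq> 0" "c * G0 = c' * G0'" "c * G1 = c' * G1'" "c * G2 = c' * G2'"
    using G unfolding G' G'' by auto
  define e where "e = (\<lambda>P. eval3 const3 P G0 G1 G2)"
  define e' where "e' = (\<lambda>P. eval3 const3 P G0' G1' G2')"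
  have "comm_ring_hom e'"
    unfolding e'_def by (intro comm_ring_hom_eval3 comm_ring_hom_const3)
  note e'_hom = comm_ring_hom_simps[OF this]
  have scale: "c ^ d * e P = c' ^ d * e' P" if "homogeneous d P" for P
    unfolding e_def e'_def eval3_homogeneous[OF that comm_ring_hom_const3, symmetric] c ..
  have cross: "e P * e' S = e R * e' T"
    if "homogeneous d P" "homogeneous d R" "P * S = R * T" for P R S T
  proof -
    have "c ^ d * (e P * e' S) = c' ^ d * (e' P * e' S)"
      using scale[OF that(1)] by (simp add: mult.assoc[symmetric])
    also have "e' P * e' S = e' R * e' T"
      using arg_cong[OF that(3), of e'] by (simp add: e'_hom)
    also have "c' ^ d * (e' R * e' T) = c ^ d * (e R * e' T)"
      using scale[OF that(2)] by (simp add: mult.assoc[symmetric])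
    finally show ?thesis using c(1) by simp
  qed
  have comp: "comp_triple F G = (e F0, e F1, e F2)" "comp_triple F' G' = (e' F0', e' F1', e' F2')"
    by (simp_all add: comp_triple_def e_def e'_def F' F'' G' G'')
  have hom: "homogeneous d F0" "homogeneous d F1" "homogeneous d F2"
    using F(1) F' by auto
  note FF' = proportional_cross[OF F(2)[unfolded F' F'']]
  show ?thesis
    using nz unfolding comp
    by (intro proportional_if_cross cross[OF hom(1,2) FF'(1)] cross[OF hom(1,3) FF'(2)]
        cross[OF hom(2,3) FF'(3)])
qed

lemma ratmap_comp_represents:
  assumes "represents F g" "represents G h" "comp_triple F G \<noteq> (0, 0, 0)"
  shows "represents (comp_triple F G) (ratmap_comp g h)"
proof -
  obtain d e where hom: "hom_triple d F" "hom_triple e G"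
    using assms by (auto simp: represents_def)
  note FG = hom_triple_comp_triple[OF hom assms(3)]
  have "ratmap_comp g h = abs_ratmap (comp_triple F G)"
    unfolding ratmap_comp_def
  proof (rule the_equality)
    show "\<exists>F' G'. represents F' g \<and> represents G' h \<and> comp_triple F' G' \<noteq> (0, 0, 0) \<and>
        represents (comp_triple F' G') (abs_ratmap (comp_triple F G))"
      using assms represents_abs_ratmap[OF FG] by blast
  next
    fix k
    assume "\<exists>F' G'. represents F' g \<and> represents G' h \<and> comp_triple F' G' \<noteq> (0, 0, 0) \<and>
        represents (comp_triple F' G') k"
    then obtain F' G' where 1: "represents F' g" "represents G' h" "comp_triple F' G' \<noteq> (0, 0, 0)"
        "represents (comp_triple F' G') k" by blast
    then obtain d' where k: "hom_triple d' (comp_triple F' G')" "k = abs_ratmap (comp_triple F' G')"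
      by (auto simp: represents_def)
    have "proportional (comp_triple F G) (comp_triple F' G')"
      using comp_triple_cong[OF hom(1)] represents_proportional 1 assms by blast
    then show "k = abs_ratmap (comp_triple F G)"
      using k abs_ratmap_eq_iff[OF FG k(1)] by simp
  qed
  then show ?thesis using represents_abs_ratmap[OF FG] by simp
qed

section \<open>Rational maps in the affine chart\<close>

lemma eval3_id: "eval3 id P x y z = poly (poly (poly P [:[:z:]:]) [:y:]) x"
proof -
  have "comm_ring_hom (\<lambda>P. poly (poly (poly P [:[:z:]:]) [:y:]) x)"
    by (rule comm_ring_homI) simp_all
  from comm_ring_hom_eq_eval3[OF this, of P] show ?thesis
    by (simp add: const3_def varX_def varY_def varZ_def id_def)
qed

text \<open>
  Restriction to the line \<open>{(x, y, z) | z \<in> \<complex>}\<close>: coefficients are evaluated at \<open>(x, y)\<close>, and \<open>Z\<close> remains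
  as the variable.
\<close>

lemma poly_map_poly_eval_line: "poly (map_poly (\<lambda>C. poly (poly C [:y:]) x) P) z = eval3 id P x y z"
proof -
  have "comm_ring_hom (\<lambda>C::complex poly poly. poly (poly C [:y:]) x)"
    by (rule comm_ring_homI) simp_all
  note hom = this
  from comm_ring_hom_eq_eval3[OF comm_ring_hom_eval_poly[OF hom, of z], of P] show ?thesis
    by (simp add: const3_def varX_def varY_def varZ_def map_poly_pCons_ring_hom[OF hom] id_def one_pCons)
qed

lemma eval3_id_1: "eval3 id P x y 1 = poly (poly (poly P 1) [:y:]) x"
  by (simp add: eval3_id pCons_one)

lemma poly_eq_0_if_zero_on_constants:
  fixes Q :: "'a::idom poly poly"
  assumes "infinite S" "\<And>y. y \<in> S \<Longrightarrow> poly Q [:y:] = 0"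
  shows "Q = 0"
proof (rule ccontr)
  assume "Q \<noteq> 0"
  then have "finite {x. poly Q x = 0}" by (rule poly_roots_finite)
  moreover have "(\<lambda>y. [:y:]) ` S \<subseteq> {x. poly Q x = 0}" using assms(2) by auto
  moreover have "infinite ((\<lambda>y. [:y:]) ` S)"
    using assms(1) by (subst finite_image_iff) (auto simp: inj_on_def)
  ultimately show False using finite_subset by blast
qed

lemma poly2_eq_0_if_zero_everywhere:
  fixes D :: "complex poly poly"
  assumes "\<And>z w. poly (poly D [:w:]) z = 0"
  shows "D = 0"
proof (rule poly_eq_0_if_zero_on_constants[of UNIV])
  show "infinite (UNIV :: complex set)" by (rule infinite_UNIV_char_0)
  show "poly D [:w:] = 0" for w
    using assms poly_all_0_iff_0 by blast
qed

text \<open>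
  Homogeneity propagates the zeros from the plane \<open>z = 1\<close> to all points with \<open>z \<noteq> 0\<close>.
\<close>

lemma homogeneous_eq_0_if_affine_0:
  assumes "homogeneous d P" "poly P 1 = 0"
  shows "P = 0"
proof -
  have 1: "eval3 id P x y 1 = 0" for x y
    by (simp add: eval3_id_1 assms)
  have "eval3 id P x y z = 0" if "z \<noteq> 0" for x y z
    using eval3_homogeneous[OF assms(1) comm_ring_hom_id, of z "x / z" "y / z" 1] that 1 by simp
  then have 2: "poly P [:[:z:]:] = 0" if "z \<noteq> 0" for z
    using poly2_eq_0_if_zero_everywhere that by (simp add: eval3_id)
  have "infinite (- {0 :: complex})"
    using infinite_UNIV_char_0[where 'a = complex] by (metis Compl_eq_Diff_UNIV finite.emptyI infinite_remove)
  then have "infinite ((\<lambda>z::complex. [:z:]) ` (- {0}))"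
    by (subst finite_image_iff) (auto simp: inj_on_def)
  then show ?thesis
    by (rule poly_eq_0_if_zero_on_constants) (use 2 in auto)
qed

text \<open>
  Off the union of the two exceptional curves both triples compute \<open>\<phi>\<close>. Multiplying a minor with the
  equations of the curves gives a polynomial that vanishes at all points of the chart.
\<close>

lemma in_chart_unique:
  assumes "in_chart g \<phi>" "in_chart g' \<phi>"
  shows "g = g'"
proof -
  obtain F0 F1 F2 D where F: "represents (F0, F1, F2) g" "D \<noteq> 0"
    "\<And>z w. poly (poly D [:w:]) z \<noteq> 0 \<Longrightarrow> eval3 id F2 z w 1 \<noteq> 0 \<and>
      \<phi> (z, w) = (eval3 id F0 z w 1 / eval3 id F2 z w 1, eval3 id F1 z w 1 / eval3 id F2 z w 1)"
    using assms(1) unfolding in_chart_def by auto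
  obtain F0' F1' F2' D' where F': "represents (F0', F1', F2') g'" "D' \<noteq> 0"
    "\<And>z w. poly (poly D' [:w:]) z \<noteq> 0 \<Longrightarrow> eval3 id F2' z w 1 \<noteq> 0 \<and>
      \<phi> (z, w) = (eval3 id F0' z w 1 / eval3 id F2' z w 1, eval3 id F1' z w 1 / eval3 id F2' z w 1)"
    using assms(2) unfolding in_chart_def by auto
  obtain d d' where d: "hom_triple d (F0, F1, F2)" "hom_triple d' (F0', F1', F2')"
      "g = abs_ratmap (F0, F1, F2)" "g' = abs_ratmap (F0', F1', F2')"
    using F(1) F'(1) by (auto simp: represents_def)
  have nz: "F2 \<noteq> 0" "F2' \<noteq> 0"
    using F(2,3) F'(2,3) poly2_eq_0_if_zero_everywhere[of D] poly2_eq_0_if_zero_everywhere[of D']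
    by (force simp: eval3_id)+
  have ratio: "eval3 id F0 z w 1 / eval3 id F2 z w 1 = eval3 id F0' z w 1 / eval3 id F2' z w 1"
    "eval3 id F1 z w 1 / eval3 id F2 z w 1 = eval3 id F1' z w 1 / eval3 id F2' z w 1"
    if "poly (poly D [:w:]) z \<noteq> 0" "poly (poly D' [:w:]) z \<noteq> 0" for z w
    using F(3)[OF that(1)] F'(3)[OF that(2)] by simp_all
  have cross: "F2' * H = F2 * H'"
    if "homogeneous d H" "homogeneous d' H'"
      "\<And>z w. poly (poly D [:w:]) z \<noteq> 0 \<Longrightarrow> poly (poly D' [:w:]) z \<noteq> 0 \<Longrightarrow>
         eval3 id H z w 1 / eval3 id F2 z w 1 = eval3 id H' z w 1 / eval3 id F2' z w 1" for H H'
  proof -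
    define K where "K = F2' * H - F2 * H'"
    have "homogeneous (d + d') K"
      unfolding K_def using d that(1,2) homogeneous_mult[of d' F2' d H] homogeneous_mult[of d F2 d' H']
      by (intro homogeneous_diff) (simp_all add: add.commute)
    have "poly (poly (D * D' * poly K 1) [:w:]) z = 0" for z w
    proof (cases "poly (poly D [:w:]) z = 0 \<or> poly (poly D' [:w:]) z = 0")
      case False
      then show ?thesis
        using that(3)[of w z] F(3)[of w z] F'(3)[of w z]
        by (auto simp: K_def eval3_id_1 field_simps)
    qed auto
    then have "D * D' * poly K 1 = 0" by (rule poly2_eq_0_if_zero_everywhere)
    then have "poly K 1 = 0" using F(2) F'(2) by simp
    then have "K = 0" by (rule homogeneous_eq_0_if_affine_0[OF \<open>homogeneous (d + d') K\<close>])
    then show ?thesis by (simp add: K_def)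
  qed
  have "F2' * F0 = F2 * F0'" "F2' * F1 = F2 * F1'"
    using d ratio by (auto intro!: cross)
  then have "proportional (F0, F1, F2) (F0', F1', F2')"
    using nz unfolding proportional.simps
    by (intro exI[of _ F2'] exI[of _ F2]) (simp add: mult.commute)
  then show ?thesis
    using abs_ratmap_eq_iff[OF d(1,2)] d(3,4) by blast
qed

lemma ratmap_of_eq: "in_chart g \<phi> \<Longrightarrow> ratmap_of \<phi> = g"
  unfolding ratmap_of_def using in_chart_unique by blast

section \<open>Lower bound for the degree from lines\<close>

lemma infinite_unit_circle: "infinite {z. cmod z = 1}"
proof -
  have "(\<lambda>t. Complex t (sqrt (1 - t\<^sup>2))) ` {0..1} \<subseteq> {z. cmod z = 1}"
    by (auto simp: cmod_def power_le_one)
  moreover have "infinite ((\<lambda>t. Complex t (sqrt (1 - t\<^sup>2))) ` {0..1})"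
    by (subst finite_image_iff) (auto simp: inj_on_def infinite_Icc)
  ultimately show ?thesis using finite_subset by blast
qed

lemma coprime_if_no_common_root:
  fixes p q :: "complex poly"
  assumes "\<And>x. poly p x = 0 \<Longrightarrow> poly q x \<noteq> 0"
  shows "coprime p q"
proof (rule coprimeI)
  fix r assume "r dvd p" "r dvd q"
  then have "poly r x \<noteq> 0" for x
    using assms[of x] by (auto elim!: dvdE)
  then have "degree r = 0"
    using fundamental_theorem_of_algebra[of r] constant_degree[of r] by blast
  moreover have "r \<noteq> 0" using \<open>\<And>x. poly r x \<noteq> 0\<close>[of 0] by auto
  ultimately show "is_unit r"
    by (simp add: is_unit_iff_degree)
qed

lemma homogeneous_degree_le: "homogeneous d P \<Longrightarrow> degree P \<le> d"
proof (rule degree_le, intro allI impI)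
  fix k assume "homogeneous d P" "d < k"
  then show "coeff P k = 0"
    by (intro poly_eqI) (auto simp: homogeneous_def)
qed

text \<open>
  The only monomial of degree \<open>d\<close> with \<open>Z\<close>-degree \<open>d\<close> is \<open>Z^d\<close>. So the degree of the restriction to a
  line with \<open>x\<close> and \<open>y\<close> fixed can be read off from the value at \<open>(0, 0, 1)\<close>.
\<close>

lemma coeff_top_homogeneous:
  assumes "homogeneous d Q"
  shows "coeff Q d = [:[:eval3 id Q 0 0 1:]:]"
proof -
  have zero: "coeff (coeff (coeff Q k) j) i = 0" if "i + j + k \<noteq> d" for i j k
    using assms that by (auto simp: homogeneous_def)
  have c: "coeff Q d = [:[:coeff (coeff (coeff Q d) 0) 0:]:]"
    by (intro poly_eqI) (auto simp: zero coeff_pCons split: nat.split)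
  have "map_poly (\<lambda>C. poly (poly C 0) 0) Q = monom (coeff (coeff (coeff Q d) 0) 0) d"
    by (intro poly_eqI) (auto simp: coeff_map_poly poly_0_coeff_0 zero)
  then have "eval3 id Q 0 0 1 = coeff (coeff (coeff Q d) 0) 0"
    using poly_map_poly_eval_line[of 0 0 Q 1] by (simp add: poly_monom)
  with c show ?thesis by simp
qed

text \<open>
  \<open>F0/F2 = P/Q\<close>, and the fraction on the right is in lowest terms on each line with \<open>x\<close> and \<open>y\<close> fixed on
  the unit circle. On a line on which \<open>F2\<close> is not identically zero, \<open>Q\<close> divides \<open>F2\<close>, and \<open>Q\<close> still has degree
  \<open>r\<close> there.
\<close>

lemma degree_lower_bound:
  assumes F: "homogeneous d F2" "F2 \<noteq> 0" and Q: "homogeneous r Q"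
    and eq: "F0 * Q = P * F2"
    and coprime: "\<And>x y z. cmod x = 1 \<Longrightarrow> cmod y = 1 \<Longrightarrow> eval3 id P x y z = 0 \<Longrightarrow> eval3 id Q x y z \<noteq> 0"
    and top: "eval3 id Q 0 0 1 \<noteq> 0"
  shows "r \<le> d"
proof -
  \<comment> \<open>The circle is infinite, so some point \<open>(x, y)\<close> on the torus is not a zero of the leading coefficient.\<close>
  have "lead_coeff F2 \<noteq> 0" using F by simp
  then obtain y where y: "cmod y = 1" "poly (lead_coeff F2) [:y:] \<noteq> 0"
    using poly_eq_0_if_zero_on_constants[OF infinite_unit_circle, of "lead_coeff F2"] by auto
  then have "finite {x. poly (poly (lead_coeff F2) [:y:]) x = 0}"
    by (intro poly_roots_finite)
  then obtain x where x: "cmod x = 1" "poly (poly (lead_coeff F2) [:y:]) x \<noteq> 0"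
    using infinite_unit_circle finite_subset by (metis (mono_tags, lifting) mem_Collect_eq subsetI)
  define e where "e = (\<lambda>C::complex poly poly. poly (poly C [:y:]) x)"
  define h where "h = map_poly e"
  have h_coeff: "coeff (h P) k = e (coeff P k)" for P k
    unfolding h_def by (rule coeff_map_poly) (simp add: e_def)
  have h_eval: "poly (h P) z = eval3 id P x y z" for P z
    unfolding h_def e_def by (rule poly_map_poly_eval_line)
  have "h F0 * h Q = h P * h F2"
    unfolding poly_eq_poly_eq_iff[symmetric]
    using eq by (auto simp: h_eval comm_ring_hom_simps[OF comm_ring_hom_eval3[OF comm_ring_hom_id], symmetric])
  then have "h Q dvd h P * h F2" by (metis dvd_triv_right)
  moreover have "coprime (h P) (h Q)"
    using coprime[OF x(1) y(1)] by (intro coprime_if_no_common_root) (simp add: h_eval)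
  ultimately have "h Q dvd h F2"
    by (metis coprime_commute coprime_dvd_mult_right_iff)
  moreover have "h F2 \<noteq> 0"
    using x(2) h_coeff[of F2 "degree F2"] by (auto simp: e_def)
  ultimately have "degree (h Q) \<le> degree (h F2)" by (rule dvd_imp_degree_le)
  also have "\<dots> \<le> degree F2" by (simp add: h_def degree_map_poly_le)
  also have "\<dots> \<le> d" using F(1) by (rule homogeneous_degree_le)
  finally show ?thesis
    using h_coeff[of Q r] top coeff_top_homogeneous[OF Q] le_degree[of "h Q" r]
    by (simp add: e_def)
qed

section \<open>Blaschke products as fractions\<close>

text \<open>
  For \<open>z = P/Q\<close> and \<open>w = U/V\<close>, the value of a Blaschke product with zeros \<open>a\<close> in \<open>z\<close> and \<open>b\<close> in \<open>w\<close> is the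
  quotient of the following two expressions. The embedding \<open>\<iota>\<close> of the constants makes them available
  both for polynomials and for complex numbers.
\<close>

definition blaschke_num ::
    "(complex \<Rightarrow> 'a::comm_ring_1) \<Rightarrow> complex \<Rightarrow> nat \<Rightarrow> (nat \<Rightarrow> complex) \<Rightarrow> nat \<Rightarrow> (nat \<Rightarrow> complex) \<Rightarrow>
     'a \<Rightarrow> 'a \<Rightarrow> 'a \<Rightarrow> 'a \<Rightarrow> 'a" where
  "blaschke_num \<iota> \<theta> m a n b P Q U V =
     \<iota> \<theta> * (\<Prod>i=1..m. P - \<iota> (a i) * Q) * (\<Prod>i=1..n. U - \<iota> (b i) * V)"

definition blaschke_den ::
    "(complex \<Rightarrow> 'a::comm_ring_1) \<Rightarrow> nat \<Rightarrow> (nat \<Rightarrow> complex) \<Rightarrow> nat \<Rightarrow> (nat \<Rightarrow> complex) \<Rightarrow>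
     'a \<Rightarrow> 'a \<Rightarrow> 'a \<Rightarrow> 'a \<Rightarrow> 'a" where
  "blaschke_den \<iota> m a n b P Q U V =
     (\<Prod>i=1..m. Q - \<iota> (cnj (a i)) * P) * (\<Prod>i=1..n. V - \<iota> (cnj (b i)) * U)"

lemma blaschke_num_den_hom:
  assumes "comm_ring_hom h" "\<And>c. h (\<iota> c) = \<kappa> c"
  shows "h (blaschke_num \<iota> \<theta> m a n b P Q U V) = blaschke_num \<kappa> \<theta> m a n b (h P) (h Q) (h U) (h V)"
    and "h (blaschke_den \<iota> m a n b P Q U V) = blaschke_den \<kappa> m a n b (h P) (h Q) (h U) (h V)"
  by (simp_all add: blaschke_num_def blaschke_den_def comm_ring_hom_simps[OF assms(1)] assms(2))

lemma blaschke_num_den_scale: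
  "blaschke_num \<iota> \<theta> m a n b (s * P) (s * Q) (t * U) (t * V) = s ^ m * t ^ n * blaschke_num \<iota> \<theta> m a n b P Q U V"
  "blaschke_den \<iota> m a n b (s * P) (s * Q) (t * U) (t * V) = s ^ m * t ^ n * blaschke_den \<iota> m a n b P Q U V"
proof -
  have lin: "s * X - c * (s * Y) = s * (X - c * Y)" for s X Y c :: 'a
    by (simp add: algebra_simps)
  show "blaschke_num \<iota> \<theta> m a n b (s * P) (s * Q) (t * U) (t * V) = s ^ m * t ^ n * blaschke_num \<iota> \<theta> m a n b P Q U V"
    "blaschke_den \<iota> m a n b (s * P) (s * Q) (t * U) (t * V) = s ^ m * t ^ n * blaschke_den \<iota> m a n b P Q U V"
    unfolding blaschke_num_def blaschke_den_def lin prod.distrib prod_constant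
    by (simp_all add: ac_simps)
qed

lemma homogeneous_blaschke_num_den:
  assumes "homogeneous r P" "homogeneous r Q" "homogeneous s U" "homogeneous s V"
  shows "homogeneous (m * r + n * s) (blaschke_num const3 \<theta> m a n b P Q U V)"
    and "homogeneous (m * r + n * s) (blaschke_den const3 m a n b P Q U V)"
proof -
  have lin: "homogeneous k (X - const3 c * Y)" if "homogeneous k X" "homogeneous k Y" for k X Y c
    using homogeneous_diff[OF that(1) homogeneous_mult[OF homogeneous_vars(1) that(2), unfolded add_0]] .
  have prod: "homogeneous (j * k) (\<Prod>i=1..j. X i)" if "\<And>i. homogeneous k (X i)" for j k X
    using homogeneous_prod[of "{1..j}" "\<lambda>_. k" X] that by simp
  show "homogeneous (m * r + n * s) (blaschke_num const3 \<theta> m a n b P Q U V)"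
    using homogeneous_mult[OF homogeneous_mult[OF homogeneous_vars(1) prod] prod] lin assms
    unfolding blaschke_num_def by (metis add_0)
  show "homogeneous (m * r + n * s) (blaschke_den const3 m a n b P Q U V)"
    unfolding blaschke_den_def by (intro homogeneous_mult prod lin assms)
qed

text \<open>
  The classical identity behind the fact that Blaschke factors preserve the disc, the circle and the
  exterior of the disc; in this homogeneous form it also covers the value \<open>\<infinity>\<close>, where \<open>q = 0\<close>.
\<close>

lemma blaschke_factor_norm_identity:
  "(cmod (q - cnj a * p))\<^sup>2 - (cmod (p - a * q))\<^sup>2 = (1 - (cmod a)\<^sup>2) * ((cmod q)\<^sup>2 - (cmod p)\<^sup>2)"
  unfolding cmod_power2 by (simp add: power2_eq_square algebra_simps)

lemma blaschke_factor_norm: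
  assumes "cmod a < 1"
  shows "cmod p < cmod q \<Longrightarrow> cmod (p - a * q) < cmod (q - cnj a * p)"
    and "cmod p = cmod q \<Longrightarrow> cmod (p - a * q) = cmod (q - cnj a * p)"
    and "cmod q < cmod p \<Longrightarrow> cmod (q - cnj a * p) < cmod (p - a * q)"
    and "cmod p = cmod q \<Longrightarrow> q \<noteq> 0 \<Longrightarrow> q - cnj a * p \<noteq> 0"
proof -
  have pos: "1 - (cmod a)\<^sup>2 > 0"
    using assms by (simp add: power_less_one_iff abs_square_less_1)
  note id = blaschke_factor_norm_identity[of q a p]
  {
    assume "cmod p < cmod q"
    then have "(cmod p)\<^sup>2 < (cmod q)\<^sup>2" by (intro power_strict_mono) auto
    then have "(cmod (p - a * q))\<^sup>2 < (cmod (q - cnj a * p))\<^sup>2"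
      using id mult_pos_pos[OF pos, of "(cmod q)\<^sup>2 - (cmod p)\<^sup>2"] by simp
    then show "cmod (p - a * q) < cmod (q - cnj a * p)" by (rule power2_less_imp_less) simp
  next
    assume "cmod p = cmod q"
    then have "(cmod (p - a * q))\<^sup>2 = (cmod (q - cnj a * p))\<^sup>2"
      using id by simp
    then show "cmod (p - a * q) = cmod (q - cnj a * p)" by simp
  next
    assume "cmod q < cmod p"
    then have "(cmod q)\<^sup>2 < (cmod p)\<^sup>2" by (intro power_strict_mono) auto
    then have "(cmod (q - cnj a * p))\<^sup>2 < (cmod (p - a * q))\<^sup>2"
      using id mult_pos_neg[OF pos, of "(cmod q)\<^sup>2 - (cmod p)\<^sup>2"] by simp
    then show "cmod (q - cnj a * p) < cmod (p - a * q)" by (rule power2_less_imp_less) simp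
  next
    assume "cmod p = cmod q" "q \<noteq> 0"
    then have "cmod (cnj a * p) < cmod q"
      using assms by (simp add: norm_mult)
    then show "q - cnj a * p \<noteq> 0" by auto
  }
qed

lemma prod_strict_mono_atLeastAtMost:
  fixes f g :: "nat \<Rightarrow> real"
  assumes "k \<ge> 1" "\<And>i. i \<in> {1..k} \<Longrightarrow> 0 \<le> f i \<and> f i < g i"
  shows "(\<Prod>i=1..k. f i) < (\<Prod>i=1..k. g i)"
  using assms by (intro prod_mono_strict[of 1]) (auto intro: less_imp_le le_less_trans)

lemma blaschke_num_den_norm:
  assumes "m \<ge> 1" "n \<ge> 1" "cmod \<theta> = 1"
    and a: "\<And>i. i \<in> {1..m} \<Longrightarrow> cmod (a i) < 1" and b: "\<And>i. i \<in> {1..n} \<Longrightarrow> cmod (b i) < 1"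
  shows "cmod p < cmod q \<Longrightarrow> cmod u < cmod v \<Longrightarrow>
      cmod (blaschke_num id \<theta> m a n b p q u v) < cmod (blaschke_den id m a n b p q u v)"
    and "cmod q < cmod p \<Longrightarrow> cmod v < cmod u \<Longrightarrow>
      cmod (blaschke_den id m a n b p q u v) < cmod (blaschke_num id \<theta> m a n b p q u v)"
    and "cmod p = cmod q \<Longrightarrow> cmod u = cmod v \<Longrightarrow>
      cmod (blaschke_num id \<theta> m a n b p q u v) = cmod (blaschke_den id m a n b p q u v)"
    and "cmod p = cmod q \<Longrightarrow> q \<noteq> 0 \<Longrightarrow> cmod u = cmod v \<Longrightarrow> v \<noteq> 0 \<Longrightarrow>
      blaschke_den id m a n b p q u v \<noteq> 0"
proof -
  have num: "cmod (blaschke_num id \<theta> m a n b p q u v) =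
      (\<Prod>i=1..m. cmod (p - a i * q)) * (\<Prod>i=1..n. cmod (u - b i * v))"
    by (simp add: blaschke_num_def norm_mult prod_norm assms)
  have den: "cmod (blaschke_den id m a n b p q u v) =
      (\<Prod>i=1..m. cmod (q - cnj (a i) * p)) * (\<Prod>i=1..n. cmod (v - cnj (b i) * u))"
    by (simp add: blaschke_den_def norm_mult prod_norm)
  show "cmod (blaschke_num id \<theta> m a n b p q u v) < cmod (blaschke_den id m a n b p q u v)"
    if "cmod p < cmod q" "cmod u < cmod v"
    unfolding num den using that assms
    by (intro mult_strict_mono' prod_strict_mono_atLeastAtMost prod_nonneg conjI blaschke_factor_norm(1)) auto
  show "cmod (blaschke_den id m a n b p q u v) < cmod (blaschke_num id \<theta> m a n b p q u v)"
    if "cmod q < cmod p" "cmod v < cmod u"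
    unfolding num den using that assms
    by (intro mult_strict_mono' prod_strict_mono_atLeastAtMost prod_nonneg conjI blaschke_factor_norm(3)) auto
  show "cmod (blaschke_num id \<theta> m a n b p q u v) = cmod (blaschke_den id m a n b p q u v)"
    if "cmod p = cmod q" "cmod u = cmod v"
    unfolding num den using that assms
    by (intro arg_cong2[of _ _ _ _ "(*)"] prod.cong refl blaschke_factor_norm(2)) auto
  show "blaschke_den id m a n b p q u v \<noteq> 0"
    if "cmod p = cmod q" "q \<noteq> 0" "cmod u = cmod v" "v \<noteq> 0"
    using that a b blaschke_factor_norm(4) by (auto simp: blaschke_den_def)
qed

section \<open>Iterates of a Blaschke product\<close>

locale blaschke_data =
  fixes m n p q :: nat and \<theta>1 \<theta>2 :: complex and a b c d :: "nat \<Rightarrow> complex"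
  assumes exponents: "m \<ge> 1" "n \<ge> 1" "p \<ge> 1" "q \<ge> 1"
    and unimodular: "cmod \<theta>1 = 1" "cmod \<theta>2 = 1"
    and zeros: "\<And>i. i \<in> {1..m} \<Longrightarrow> cmod (a i) < 1" "\<And>i. i \<in> {1..n} \<Longrightarrow> cmod (b i) < 1"
      "\<And>i. i \<in> {1..p} \<Longrightarrow> cmod (c i) < 1" "\<And>i. i \<in> {1..q} \<Longrightarrow> cmod (d i) < 1"
begin

definition fraction_step :: "poly3 \<times> poly3 \<times> poly3 \<times> poly3 \<Rightarrow> poly3 \<times> poly3 \<times> poly3 \<times> poly3" where
  "fraction_step = (\<lambda>(P, Q, U, V).
     (blaschke_num const3 \<theta>1 m a n b P Q U V, blaschke_den const3 m a n b P Q U V,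
      blaschke_num const3 \<theta>2 p c q d P Q U V, blaschke_den const3 p c q d P Q U V))"

text \<open>
  The fractions \<open>P/Q\<close> and \<open>U/V\<close> of the \<open>k\<close>-th iterate in homogeneous coordinates, starting from
  \<open>z = X/Z\<close> and \<open>w = Y/Z\<close>.
\<close>

definition fractions :: "nat \<Rightarrow> poly3 \<times> poly3 \<times> poly3 \<times> poly3" where
  "fractions k = (fraction_step ^^ k) (varX, varZ, varY, varZ)"

definition fraction_degrees :: "nat \<Rightarrow> nat \<times> nat" where
  "fraction_degrees k = ((\<lambda>(r, s). (m * r + n * s, p * r + q * s)) ^^ k) (1, 1)"

definition common_denominator :: "poly3 \<times> poly3 \<times> poly3 \<times> poly3 \<Rightarrow> triple" where
  "common_denominator = (\<lambda>(P, Q, U, V). (P * V, U * Q, Q * V))"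

lemma fractions_0: "fractions 0 = (varX, varZ, varY, varZ)"
  by (simp add: fractions_def)

lemma fractions_Suc:
  "fractions k = (P, Q, U, V) \<Longrightarrow> fractions (Suc k) =
     (blaschke_num const3 \<theta>1 m a n b P Q U V, blaschke_den const3 m a n b P Q U V,
      blaschke_num const3 \<theta>2 p c q d P Q U V, blaschke_den const3 p c q d P Q U V)"
  by (simp add: fractions_def fraction_step_def)

lemma homogeneous_fractions:
  "fractions k = (P, Q, U, V) \<Longrightarrow> fraction_degrees k = (r, s) \<Longrightarrow>
   homogeneous r P \<and> homogeneous r Q \<and> homogeneous s U \<and> homogeneous s V"
proof (induction k arbitrary: P Q U V r s)
  case 0
  then show ?case using homogeneous_vars by (auto simp: fractions_def fraction_degrees_def)
next
  case (Suc k)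
  obtain P' Q' U' V' where "fractions k = (P', Q', U', V')" by (metis prod_cases4)
  moreover obtain r' s' where "fraction_degrees k = (r', s')" by (metis surj_pair)
  ultimately show ?case
    using Suc.IH Suc.prems fractions_Suc homogeneous_blaschke_num_den
    by (auto simp: fraction_degrees_def)
qed

text \<open>
  At points with \<open>|x| = |y|\<close>, both \<open>x/z\<close> and \<open>y/z\<close> lie in the disc, on the circle, or in the exterior. All
  Blaschke factors preserve the three cases, and so do products, as each has at least one factor.
\<close>

lemma fractions_norm:
  assumes "cmod x = cmod y" and "fractions k = (P, Q, U, V)"
  shows "cmod x < cmod z \<Longrightarrow> cmod (eval3 id P x y z) < cmod (eval3 id Q x y z) \<and>
      cmod (eval3 id U x y z) < cmod (eval3 id V x y z)"
    and "cmod z < cmod x \<Longrightarrow> cmod (eval3 id Q x y z) < cmod (eval3 id P x y z) \<and>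
      cmod (eval3 id V x y z) < cmod (eval3 id U x y z)"
    and "cmod x = cmod z \<Longrightarrow> z \<noteq> 0 \<Longrightarrow>
      cmod (eval3 id P x y z) = cmod (eval3 id Q x y z) \<and> eval3 id Q x y z \<noteq> 0 \<and>
      cmod (eval3 id U x y z) = cmod (eval3 id V x y z) \<and> eval3 id V x y z \<noteq> 0"
proof -
  define e where "e = (\<lambda>P. eval3 id P x y z)"
  have hom: "comm_ring_hom e" unfolding e_def by (intro comm_ring_hom_eval3 comm_ring_hom_id)
  have gens: "e (const3 t) = id t" "e varX = x" "e varY = y" "e varZ = z" for t
    by (simp_all add: e_def eval3_gens comm_ring_hom_id)
  note num_den = blaschke_num_den_hom[OF hom gens(1)]
  note norm1 = blaschke_num_den_norm[where a = a and b = b, OF exponents(1,2) unimodular(1) zeros(1,2)]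
  note norm2 = blaschke_num_den_norm[where a = c and b = d, OF exponents(3,4) unimodular(2) zeros(3,4)]
  have "(cmod x < cmod z \<longrightarrow> cmod (e P) < cmod (e Q) \<and> cmod (e U) < cmod (e V)) \<and>
    (cmod z < cmod x \<longrightarrow> cmod (e Q) < cmod (e P) \<and> cmod (e V) < cmod (e U)) \<and>
    (cmod x = cmod z \<and> z \<noteq> 0 \<longrightarrow> cmod (e P) = cmod (e Q) \<and> e Q \<noteq> 0 \<and> cmod (e U) = cmod (e V) \<and> e V \<noteq> 0)"
    using assms(2)
  proof (induction k arbitrary: P Q U V)
    case 0
    then show ?case using assms(1) by (auto simp: fractions_def gens)
  next
    case (Suc k)
    obtain P' Q' U' V' where k: "fractions k = (P', Q', U', V')" by (metis prod_cases4)
    have PQUV: "P = blaschke_num const3 \<theta>1 m a n b P' Q' U' V'"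
      "Q = blaschke_den const3 m a n b P' Q' U' V'"
      "U = blaschke_num const3 \<theta>2 p c q d P' Q' U' V'"
      "V = blaschke_den const3 p c q d P' Q' U' V'"
      using Suc.prems fractions_Suc[OF k] by simp_all
    show ?case
      unfolding PQUV num_den
      by (intro conjI impI norm1 norm2) (use Suc.IH[OF k] in auto)
  qed
  then show "cmod x < cmod z \<Longrightarrow> cmod (eval3 id P x y z) < cmod (eval3 id Q x y z) \<and>
      cmod (eval3 id U x y z) < cmod (eval3 id V x y z)"
    "cmod z < cmod x \<Longrightarrow> cmod (eval3 id Q x y z) < cmod (eval3 id P x y z) \<and>
      cmod (eval3 id V x y z) < cmod (eval3 id U x y z)"
    "cmod x = cmod z \<Longrightarrow> z \<noteq> 0 \<Longrightarrow>
      cmod (eval3 id P x y z) = cmod (eval3 id Q x y z) \<and> eval3 id Q x y z \<noteq> 0 \<and>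
      cmod (eval3 id U x y z) = cmod (eval3 id V x y z) \<and> eval3 id V x y z \<noteq> 0"
    unfolding e_def by blast+
qed

text \<open>
  The origin of the chart lies in the product of two discs, so the first case of \<open>fractions_norm\<close> applies.
\<close>

lemma fractions_den_at_origin:
  assumes "fractions k = (P, Q, U, V)"
  shows "eval3 id Q 0 0 1 \<noteq> 0" "eval3 id V 0 0 1 \<noteq> 0"
  using fractions_norm(1)[OF _ assms, of 0 0 1] by auto

lemma fractions_den_nonzero:
  assumes "fractions k = (P, Q, U, V)"
  shows "Q \<noteq> 0" "V \<noteq> 0"
  using fractions_den_at_origin[OF assms] by (auto simp: eval3_id)

lemma hom_triple_fractions:
  "fraction_degrees k = (r, s) \<Longrightarrow> hom_triple (r + s) (common_denominator (fractions k))"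
proof -
  assume "fraction_degrees k = (r, s)"
  moreover obtain P Q U V where k: "fractions k = (P, Q, U, V)" by (metis prod_cases4)
  ultimately show ?thesis
    using homogeneous_fractions[OF k] fractions_den_nonzero[OF k]
      homogeneous_mult[of r _ s] homogeneous_mult[of s _ r]
    by (simp add: common_denominator_def add.commute)
qed

definition blaschke_ratmap :: ratmap where
  "blaschke_ratmap = abs_ratmap (common_denominator (fractions 1))"

lemma represents_blaschke_ratmap: "represents (common_denominator (fractions 1)) blaschke_ratmap"
  unfolding blaschke_ratmap_def
  using represents_abs_ratmap hom_triple_fractions by (metis surj_pair)

text \<open>
  Composition with the triple of \<open>f\<close> substitutes \<open>(P V, U Q, Q V)\<close>, that is \<open>Q V\<close> times \<open>(P/Q, U/V, 1)\<close>. As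
  \<open>z\<close> becomes \<open>(V P)/(V Q)\<close> and \<open>w\<close> becomes \<open>(Q U)/(Q V)\<close>, each factor in \<open>z\<close> contributes an extra \<open>V\<close>
  and each factor in \<open>w\<close> an extra \<open>Q\<close>. These extra factors are common to the three entries.
\<close>

lemma represents_iterate: "represents (common_denominator (fractions k)) (ratmap_iter k blaschke_ratmap)"
proof (induction k)
  case 0
  have XYZ: "represents (varX, varY, varZ) (ratmap_iter 0 blaschke_ratmap)"
    using homogeneous_vars represents_abs_ratmap[of 1 "(varX, varY, varZ)"]
    by (simp add: ratmap_iter_def ratmap_id_def varX_def)
  have "varZ \<noteq> 0" by (simp add: varZ_def)
  then have "proportional (varX, varY, varZ) (common_denominator (fractions 0))"
    unfolding common_denominator_def fractions_0 prod.case proportional.simps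
    by (intro exI[of _ varZ] exI[of _ 1]) (simp add: mult.commute)
  moreover obtain r s where "fraction_degrees 0 = (r, s)" by (metis surj_pair)
  ultimately show ?case
    using represents_if_proportional[OF XYZ] hom_triple_fractions by blast
next
  case (Suc k)
  obtain P Q U V where k: "fractions k = (P, Q, U, V)" by (metis prod_cases4)
  define P' Q' U' V' where "P' = blaschke_num const3 \<theta>1 m a n b P Q U V"
    and "Q' = blaschke_den const3 m a n b P Q U V" and "U' = blaschke_num const3 \<theta>2 p c q d P Q U V"
    and "V' = blaschke_den const3 p c q d P Q U V"
  note step = this
  have Suc_k: "fractions (Suc k) = (P', Q', U', V')"
    unfolding step by (rule fractions_Suc[OF k])
  define P1 Q1 U1 V1 where "P1 = blaschke_num const3 \<theta>1 m a n b varX varZ varY varZ"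
    and "Q1 = blaschke_den const3 m a n b varX varZ varY varZ"
    and "U1 = blaschke_num const3 \<theta>2 p c q d varX varZ varY varZ"
    and "V1 = blaschke_den const3 p c q d varX varZ varY varZ"
  note step1 = this
  have one: "fractions 1 = (P1, Q1, U1, V1)"
    unfolding step1 One_nat_def by (rule fractions_Suc[OF fractions_0])
  define e where "e = (\<lambda>F. eval3 const3 F (P * V) (U * Q) (Q * V))"
  have hom: "comm_ring_hom e" unfolding e_def by (intro comm_ring_hom_eval3 comm_ring_hom_const3)
  have gens: "e (const3 t) = const3 t" "e varX = V * P" "e varY = Q * U" for t
    unfolding e_def by (simp_all add: eval3_gens comm_ring_hom_const3 mult.commute)
  define Z where "Z = Q * V"
  have Z: "e varZ = Z" and Z': "Z = V * Q" "Z = Q * V"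
    unfolding e_def Z_def by (simp_all add: eval3_gens comm_ring_hom_const3 mult.commute)
  note num_den = blaschke_num_den_hom[OF hom gens(1)]
  have num: "e (blaschke_num const3 \<theta> i f j g varX varZ varY varZ) =
      V ^ i * Q ^ j * blaschke_num const3 \<theta> i f j g P Q U V" for \<theta> i f j g
    using blaschke_num_den_scale(1)[of const3 \<theta> i f j g V P Q Q U V, folded Z']
    unfolding num_den(1) gens Z .
  have den: "e (blaschke_den const3 i f j g varX varZ varY varZ) =
      V ^ i * Q ^ j * blaschke_den const3 i f j g P Q U V" for i f j g
    using blaschke_num_den_scale(2)[of const3 i f j g V P Q Q U V, folded Z']
    unfolding num_den(2) gens Z .
  define W where "W = V ^ (m + p) * Q ^ (n + q)"
  have "W \<noteq> 0" using fractions_den_nonzero[OF k] by (simp add: W_def)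
  have e1: "e P1 = V ^ m * Q ^ n * P'" "e Q1 = V ^ m * Q ^ n * Q'"
    "e U1 = V ^ p * Q ^ q * U'" "e V1 = V ^ p * Q ^ q * V'"
    unfolding step1 step by (rule num den)+
  have "e (P1 * V1) = W * (P' * V')" "e (U1 * Q1) = W * (U' * Q')" "e (Q1 * V1) = W * (Q' * V')"
    unfolding comm_ring_hom_simps(4)[OF hom] e1 W_def power_add by (simp_all only: ac_simps)
  then have comp: "comp_triple (common_denominator (fractions 1)) (common_denominator (fractions k)) =
      (W * (P' * V'), W * (U' * Q'), W * (Q' * V'))"
    unfolding one k common_denominator_def comp_triple_def e_def by simp
  have nz: "(W * (P' * V'), W * (U' * Q'), W * (Q' * V')) \<noteq> (0, 0, 0)"
    using \<open>W \<noteq> 0\<close> fractions_den_nonzero[OF Suc_k] by simp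
  have proportional: "proportional (W * (P' * V'), W * (U' * Q'), W * (Q' * V')) (common_denominator (fractions (Suc k)))"
    unfolding Suc_k common_denominator_def prod.case proportional.simps
    by (intro exI[of _ 1] exI[of _ W]) (simp add: \<open>W \<noteq> 0\<close>)
  have "represents (W * (P' * V'), W * (U' * Q'), W * (Q' * V')) (ratmap_comp blaschke_ratmap (ratmap_iter k blaschke_ratmap))"
    using ratmap_comp_represents[OF represents_blaschke_ratmap Suc.IH] nz unfolding comp by blast
  then have "represents (common_denominator (fractions (Suc k))) (ratmap_comp blaschke_ratmap (ratmap_iter k blaschke_ratmap))"
    using represents_if_proportional[OF _ proportional] hom_triple_fractions[of "Suc k"]
    by (cases "fraction_degrees (Suc k)") blast
  then show ?case by (simp add: ratmap_iter_def)
qed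

text \<open>
  A common zero of \<open>P\<close> and \<open>Q\<close> is excluded in each of the three cases of \<open>fractions_norm\<close>.
\<close>

lemma alg_degree_iterate_bounds:
  assumes "fraction_degrees k = (r, s)"
  shows "r \<le> alg_degree (ratmap_iter k blaschke_ratmap)"
    and "alg_degree (ratmap_iter k blaschke_ratmap) \<le> r + s"
proof -
  obtain P Q U V where k: "fractions k = (P, Q, U, V)" by (metis prod_cases4)
  show "alg_degree (ratmap_iter k blaschke_ratmap) \<le> r + s"
    using alg_degree_reduced(2)[OF represents_iterate hom_triple_fractions[OF assms]] .
  obtain F where F: "hom_triple (alg_degree (ratmap_iter k blaschke_ratmap)) F"
    "represents F (ratmap_iter k blaschke_ratmap)"
    using alg_degree_reduced(1)[OF represents_iterate] by blast
  obtain F0 F1 F2 where F': "F = (F0, F1, F2)" by (cases F)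
  have proportional: "proportional (F0, F1, F2) (P * V, U * Q, Q * V)"
    using represents_proportional[OF F(2) represents_iterate] by (simp add: F' k common_denominator_def)
  note nz = fractions_den_nonzero[OF k]
  have "F2 \<noteq> 0" using proportional nz by auto
  have "V * (F0 * Q) = V * (P * F2)"
    using proportional_cross(2)[OF proportional] by (simp add: ac_simps)
  then have "F0 * Q = P * F2" using nz by simp
  moreover have "eval3 id Q x y z \<noteq> 0"
    if xy: "cmod x = 1" "cmod y = 1" and "eval3 id P x y z = 0" for x y z
  proof -
    consider "cmod x < cmod z" | "cmod z < cmod x" | "cmod x = cmod z" "z \<noteq> 0"
      using xy by (metis linorder_cases norm_zero zero_neq_one)
    then show ?thesis
      using fractions_norm[OF _ k, of x y z] that by cases auto
  qed
  ultimately show "r \<le> alg_degree (ratmap_iter k blaschke_ratmap)"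
    using degree_lower_bound[of _ F2 r Q F0 P] F(1) \<open>F2 \<noteq> 0\<close> homogeneous_fractions[OF k assms]
      fractions_den_at_origin[OF k] unfolding F' by auto
qed

lemma in_chart_blaschke_ratmap:
  "in_chart blaschke_ratmap (\<lambda>(z, w).
     (\<theta>1 * (\<Prod>i=1..m. blaschke_factor (a i) z) * (\<Prod>i=1..n. blaschke_factor (b i) w),
      \<theta>2 * (\<Prod>i=1..p. blaschke_factor (c i) z) * (\<Prod>i=1..q. blaschke_factor (d i) w)))"
proof -
  obtain P Q U V where k: "fractions 1 = (P, Q, U, V)" by (metis prod_cases4)
  have PQUV: "P = blaschke_num const3 \<theta>1 m a n b varX varZ varY varZ"
    "Q = blaschke_den const3 m a n b varX varZ varY varZ"
    "U = blaschke_num const3 \<theta>2 p c q d varX varZ varY varZ"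
    "V = blaschke_den const3 p c q d varX varZ varY varZ"
    using k fractions_Suc[OF fractions_0] by simp_all
  define D where "D = poly (Q * V) 1"
  have D: "poly (poly D [:w:]) z = eval3 id Q z w 1 * eval3 id V z w 1" for z w
    by (simp add: D_def eval3_id_1)
  have "D \<noteq> 0" using D[of 0 0] fractions_den_at_origin[OF k] by auto
  have hom: "comm_ring_hom (\<lambda>P. eval3 id P z w 1)" for z w
    by (intro comm_ring_hom_eval3 comm_ring_hom_id)
  have gens: "eval3 id (const3 t) z w 1 = id t" "eval3 id varX z w 1 = z" "eval3 id varY z w 1 = w"
     "eval3 id varZ z w 1 = 1" for t z w
    by (simp_all add: eval3_gens comm_ring_hom_id)
  have ratio: "eval3 id (blaschke_num const3 \<theta> i f j g varX varZ varY varZ) z w 1 /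
      eval3 id (blaschke_den const3 i f j g varX varZ varY varZ) z w 1 =
      \<theta> * (\<Prod>i=1..i. blaschke_factor (f i) z) * (\<Prod>i=1..j. blaschke_factor (g i) w)" for \<theta> i f j g z w
    unfolding blaschke_num_den_hom[where \<iota> = const3 and \<kappa> = id, OF hom gens(1)] gens
    by (simp add: blaschke_num_def blaschke_den_def blaschke_factor_def prod_dividef)
  have "represents (P * V, U * Q, Q * V) blaschke_ratmap"
    using represents_blaschke_ratmap unfolding k common_denominator_def prod.case .
  moreover have "eval3 id (Q * V) z w 1 \<noteq> 0 \<and>
      (\<theta>1 * (\<Prod>i=1..m. blaschke_factor (a i) z) * (\<Prod>i=1..n. blaschke_factor (b i) w),
       \<theta>2 * (\<Prod>i=1..p. blaschke_factor (c i) z) * (\<Prod>i=1..q. blaschke_factor (d i) w)) =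
      (eval3 id (P * V) z w 1 / eval3 id (Q * V) z w 1, eval3 id (U * Q) z w 1 / eval3 id (Q * V) z w 1)"
    if "poly (poly D [:w:]) z \<noteq> 0" for z w
  proof -
    have "eval3 id Q z w 1 \<noteq> 0" "eval3 id V z w 1 \<noteq> 0" using that by (auto simp: D)
    then have "eval3 id (Q * V) z w 1 \<noteq> 0"
      and quot: "eval3 id (P * V) z w 1 / eval3 id (Q * V) z w 1 = eval3 id P z w 1 / eval3 id Q z w 1"
        "eval3 id (U * Q) z w 1 / eval3 id (Q * V) z w 1 = eval3 id U z w 1 / eval3 id V z w 1"
      by (simp_all add: comm_ring_hom_simps[OF hom])
    moreover have "eval3 id P z w 1 / eval3 id Q z w 1 =
        \<theta>1 * (\<Prod>i=1..m. blaschke_factor (a i) z) * (\<Prod>i=1..n. blaschke_factor (b i) w)"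
      "eval3 id U z w 1 / eval3 id V z w 1 =
        \<theta>2 * (\<Prod>i=1..p. blaschke_factor (c i) z) * (\<Prod>i=1..q. blaschke_factor (d i) w)"
      unfolding PQUV by (rule ratio)+
    ultimately show ?thesis
      unfolding quot by (simp only: simp_thms)
  qed
  ultimately show ?thesis
    unfolding in_chart_def prod.case using \<open>D \<noteq> 0\<close>
    by (intro exI[of _ "P * V"] exI[of _ "U * Q"] exI[of _ "Q * V"] exI[of _ D] conjI) blast+
qed

section \<open>Exponential growth of the degrees\<close>

text \<open>
  The larger root of the characteristic polynomial \<open>(x - m) (x - q) - n p\<close> of \<open>N\<close>.
\<close>

definition growth_rate :: real where
  "growth_rate = (real m + real q + sqrt ((real m - real q)\<^sup>2 + 4 * real n * real p)) / 2"

lemma growth_rate_bounds: "growth_rate > m" "growth_rate > q"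
proof -
  have "\<bar>real m - real q\<bar> < sqrt ((real m - real q)\<^sup>2 + 4 * real n * real p)"
    using exponents by (intro real_less_rsqrt) simp
  then show "growth_rate > m" "growth_rate > q"
    unfolding growth_rate_def by (auto simp: abs_less_iff)
qed

lemma growth_rate_char_eq: "(growth_rate - m) * (growth_rate - q) = n * p"
proof -
  have "(2 * growth_rate - (real m + real q))\<^sup>2 = (real m - real q)\<^sup>2 + 4 * real n * real p"
    unfolding growth_rate_def by simp
  then show ?thesis by (simp add: power2_eq_square algebra_simps)
qed

text \<open>
  The vector \<open>(n, c - m)\<close> is a positive eigenvector of \<open>N\<close> for its leading eigenvalue \<open>c\<close>. The start
  \<open>(1, 1)\<close> lies between two positive multiples of it, and \<open>N\<close> preserves inequalities as its entries are not negative.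
\<close>

lemma fraction_degrees_bounds:
  "\<exists>C1 C2. C1 > 0 \<and> C2 > 0 \<and> (\<forall>k. C1 * growth_rate ^ k \<le> real (fst (fraction_degrees k)) \<and>
     real (fst (fraction_degrees k)) + real (snd (fraction_degrees k)) \<le> C2 * growth_rate ^ k)"
proof -
  define x where "x = real n"
  define y where "y = growth_rate - m"
  have pos: "x > 0" "y > 0"
    using exponents growth_rate_bounds by (simp_all add: x_def y_def)
  have eig: "m * x + n * y = growth_rate * x" "p * x + q * y = growth_rate * y"
    using growth_rate_char_eq by (simp_all add: x_def y_def algebra_simps)
  define l where "l = min (1 / x) (1 / y)"
  define u where "u = max (1 / x) (1 / y)"
  have lu: "l > 0" "u > 0" "l * x \<le> 1" "l * y \<le> 1" "1 \<le> u * x" "1 \<le> u * y"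
    using pos by (auto simp: l_def u_def min_def max_def field_simps)
  have "l * growth_rate ^ k * x \<le> fst (fraction_degrees k) \<and> l * growth_rate ^ k * y \<le> snd (fraction_degrees k) \<and>
        fst (fraction_degrees k) \<le> u * growth_rate ^ k * x \<and> snd (fraction_degrees k) \<le> u * growth_rate ^ k * y" for k
  proof (induction k)
    case 0
    then show ?case using lu by (simp add: fraction_degrees_def)
  next
    case (Suc k)
    obtain r s where rs: "fraction_degrees k = (r, s)" by (metis surj_pair)
    have Suc_k: "fraction_degrees (Suc k) = (m * r + n * s, p * r + q * s)"
      using rs by (simp add: fraction_degrees_def)
    have eig': "t * growth_rate ^ Suc k * x = m * (t * growth_rate ^ k * x) + n * (t * growth_rate ^ k * y)"
      "t * growth_rate ^ Suc k * y = p * (t * growth_rate ^ k * x) + q * (t * growth_rate ^ k * y)" for t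
    proof -
      have "t * growth_rate ^ Suc k * x = t * growth_rate ^ k * (growth_rate * x)" by simp
      then show "t * growth_rate ^ Suc k * x = m * (t * growth_rate ^ k * x) + n * (t * growth_rate ^ k * y)"
        unfolding eig(1)[symmetric] by (simp add: algebra_simps)
      have "t * growth_rate ^ Suc k * y = t * growth_rate ^ k * (growth_rate * y)" by simp
      then show "t * growth_rate ^ Suc k * y = p * (t * growth_rate ^ k * x) + q * (t * growth_rate ^ k * y)"
        unfolding eig(2)[symmetric] by (simp add: algebra_simps)
    qed
    show ?case
      unfolding eig' Suc_k fst_conv snd_conv of_nat_add of_nat_mult
      using Suc rs by (intro conjI add_mono mult_left_mono) auto
  qed
  then show ?thesis
    using lu pos by (intro exI[of _ "l * x"] exI[of _ "u * (x + y)"])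
      (auto simp: algebra_simps intro: add_mono add_pos_pos)
qed

end

lemma root_tendsto_exponential_rate:
  fixes t :: "nat \<Rightarrow> real"
  assumes "C1 > 0" "C2 > 0" "L > 0"
    and "\<And>k. C1 * L ^ k \<le> t k" "\<And>k. t k \<le> C2 * L ^ k"
  shows "(\<lambda>k. root k (t k)) \<longlonglongrightarrow> L"
proof (rule tendsto_sandwich)
  have root: "root k (C * L ^ k) = root k C * L" if "k \<ge> 1" for k C
    using that \<open>L > 0\<close> by (simp add: real_root_mult real_root_power_cancel)
  show "(\<lambda>k. root k C1 * L) \<longlonglongrightarrow> L" "(\<lambda>k. root k C2 * L) \<longlonglongrightarrow> L"
    using tendsto_mult_right[OF LIMSEQ_root_const] assms by (metis mult_1)+
  show "\<forall>\<^sub>F k in sequentially. root k C1 * L \<le> root k (t k)"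
    using eventually_ge_at_top[of 1]
  proof eventually_elim
    case (elim k)
    then show ?case
      using real_root_le_mono[of k "C1 * L ^ k" "t k"] assms(4)[of k] root[of k C1] by simp
  qed
  show "\<forall>\<^sub>F k in sequentially. root k (t k) \<le> root k C2 * L"
    using eventually_ge_at_top[of 1]
  proof eventually_elim
    case (elim k)
    then show ?case
      using real_root_le_mono[of k "t k" "C2 * L ^ k"] assms(5)[of k] root[of k C2] by simp
  qed
qed

lemma (in blaschke_data) degree_growth_tendsto: "degree_growth blaschke_ratmap \<longlonglongrightarrow> growth_rate"
proof -
  obtain C1 C2 where C: "C1 > 0" "C2 > 0"
    "\<And>k. C1 * growth_rate ^ k \<le> fst (fraction_degrees k)" "\<And>k. real (fst (fraction_degrees k)) + real (snd (fraction_degrees k)) \<le> C2 * growth_rate ^ k"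
    using fraction_degrees_bounds by blast
  have "growth_rate > 0" using growth_rate_bounds(1) by simp
  show ?thesis
    unfolding degree_growth_def
  proof (rule root_tendsto_exponential_rate[OF C(1,2) \<open>growth_rate > 0\<close>])
    fix k
    obtain r s where rs: "fraction_degrees k = (r, s)" by (metis surj_pair)
    show "C1 * growth_rate ^ k \<le> alg_degree (ratmap_iter k blaschke_ratmap)"
      "alg_degree (ratmap_iter k blaschke_ratmap) \<le> C2 * growth_rate ^ k"
      using C(3,4)[of k] alg_degree_iterate_bounds[OF rs] by (simp_all add: rs)
  qed
qed

lemma degree_growth_blaschke_product:
  assumes "m \<ge> 1" "n \<ge> 1" "p \<ge> 1" "q \<ge> 1" "f \<in> blaschke_products m n p q"
  shows "degree_growth (ratmap_of f) \<longlonglongrightarrow>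
     (real m + real q + sqrt ((real m - real q)\<^sup>2 + 4 * real n * real p)) / 2"
proof -
  obtain \<theta>1 \<theta>2 a b c d where *: "cmod \<theta>1 = 1" "cmod \<theta>2 = 1"
    "\<forall>i\<in>{1..m}. cmod (a i) < 1" "\<forall>i\<in>{1..n}. cmod (b i) < 1"
    "\<forall>i\<in>{1..p}. cmod (c i) < 1" "\<forall>i\<in>{1..q}. cmod (d i) < 1" and
    f: "f = (\<lambda>(z, w).
      (\<theta>1 * (\<Prod>i=1..m. blaschke_factor (a i) z) * (\<Prod>i=1..n. blaschke_factor (b i) w),
       \<theta>2 * (\<Prod>i=1..p. blaschke_factor (c i) z) * (\<Prod>i=1..q. blaschke_factor (d i) w)))"
    using assms(5) unfolding blaschke_products_def by blast
  interpret blaschke_data m n p q \<theta>1 \<theta>2 a b c d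
    by unfold_locales (use assms * in auto)
  have "ratmap_of f = blaschke_ratmap"
    unfolding f by (rule ratmap_of_eq[OF in_chart_blaschke_ratmap])
  then show ?thesis using degree_growth_tendsto by (simp add: growth_rate_def)
qed

lemma monomial_map_is_blaschke_product: "monomial_map m n p q \<in> blaschke_products m n p q"
  unfolding blaschke_products_def monomial_map_def
  by (intro CollectI exI[of _ 1] exI[of _ "\<lambda>_. 0"]) (simp add: blaschke_factor_def)

section \<open>The leading eigenvalue\<close>

text \<open>
  As \<open>n \<noteq> 0\<close>, an eigenvector has a nonzero first entry, and \<open>(n, x - m)\<close> is one when the equation holds.
\<close>

lemma eigenvalue_2x2_iff:
  fixes m n p q x :: real
  assumes "n \<noteq> 0"
  shows "eigenvalue (mat_of_rows_list 2 [[m, n], [p, q]]) x \<longleftrightarrow> (x - m) * (x - q) = n * p"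
proof -
  let ?A = "mat_of_rows_list 2 [[m, n], [p, q]]"
  have dim: "dim_row ?A = 2" "dim_col ?A = 2" by (simp_all add: mat_of_rows_list_def)
  have mult: "?A *\<^sub>v v = x \<cdot>\<^sub>v v \<longleftrightarrow> m * v $ 0 + n * v $ 1 = x * v $ 0 \<and> p * v $ 0 + q * v $ 1 = x * v $ 1"
    if "v \<in> carrier_vec 2" for v
    using that dim
    by (auto simp: vec_eq_iff mat_of_rows_list_def scalar_prod_def numeral_2_eq_2 less_Suc_eq)
  have nz: "v \<noteq> 0\<^sub>v 2 \<longleftrightarrow> v $ 0 \<noteq> 0 \<or> v $ 1 \<noteq> 0" if "v \<in> carrier_vec 2" for v :: "real vec"
    using that by (auto simp: vec_eq_iff less_2_cases_iff)
  show ?thesis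
  proof
    assume "eigenvalue ?A x"
    then obtain v where v: "v \<in> carrier_vec 2" "v $ 0 \<noteq> 0 \<or> v $ 1 \<noteq> 0"
      "m * v $ 0 + n * v $ 1 = x * v $ 0" "p * v $ 0 + q * v $ 1 = x * v $ 1"
      unfolding eigenvalue_def eigenvector_def dim using nz mult by blast
    have "v $ 0 \<noteq> 0" using v assms by auto
    have "n * v $ 1 = (x - m) * v $ 0" "(x - q) * v $ 1 = p * v $ 0"
      using v(3,4) by (simp_all add: algebra_simps)
    then have "(x - m) * (x - q) * v $ 0 = n * p * v $ 0"
      by (metis mult.assoc mult.commute)
    then show "(x - m) * (x - q) = n * p" using \<open>v $ 0 \<noteq> 0\<close> by simp
  next
    assume eq: "(x - m) * (x - q) = n * p"
    define v where "v = vec 2 (\<lambda>i. if i = 0 then n else x - m)"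
    have v: "v \<in> carrier_vec 2" "v $ 0 = n" "v $ 1 = x - m"
      by (simp_all add: v_def)
    have "?A *\<^sub>v v = x \<cdot>\<^sub>v v"
      unfolding mult[OF v(1)] v(2,3) using eq by (simp add: algebra_simps)
    then show "eigenvalue ?A x"
      unfolding eigenvalue_def eigenvector_def dim using nz[OF v(1)] v assms by auto
  qed
qed

lemma largest_eigenvalue_2x2:
  assumes "n \<ge> 1"
  shows "largest_eigenvalue (mat_of_rows_list 2 [[int m, int n], [int p, int q]]) =
    (real m + real q + sqrt ((real m - real q)\<^sup>2 + 4 * real n * real p)) / 2"
proof -
  let ?s = "sqrt ((real m - real q)\<^sup>2 + 4 * real n * real p)"
  have mat: "map_mat real_of_int (mat_of_rows_list 2 [[int m, int n], [int p, int q]]) =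
      mat_of_rows_list 2 [[real m, real n], [real p, real q]]"
    by (rule eq_matI) (auto simp: mat_of_rows_list_def less_Suc_eq numeral_2_eq_2)
  have root: "(x - real m) * (x - real q) = real n * real p \<longleftrightarrow>
      x = (real m + real q + ?s) / 2 \<or> x = (real m + real q - ?s) / 2" for x
  proof -
    have "?s\<^sup>2 = (real m - real q)\<^sup>2 + 4 * real n * real p" by simp
    then have "(x - real m) * (x - real q) = real n * real p \<longleftrightarrow> (2 * x - (real m + real q))\<^sup>2 = ?s\<^sup>2"
      by (auto simp: power2_eq_square algebra_simps simp del: real_sqrt_mult_self)
    also have "\<dots> \<longleftrightarrow> x = (real m + real q + ?s) / 2 \<or> x = (real m + real q - ?s) / 2"
      unfolding power2_eq_iff by auto
    finally show ?thesis .
  qed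
  have "n \<noteq> 0" using assms by simp
  then have "{x. eigenvalue (map_mat real_of_int (mat_of_rows_list 2 [[int m, int n], [int p, int q]])) x} =
      {x. (x - real m) * (x - real q) = real n * real p}"
    unfolding mat by (intro Collect_cong eigenvalue_2x2_iff) simp
  also have "\<dots> = {(real m + real q + ?s) / 2, (real m + real q - ?s) / 2}"
    unfolding root by blast
  finally have "largest_eigenvalue (mat_of_rows_list 2 [[int m, int n], [int p, int q]]) =
      Max {(real m + real q + ?s) / 2, (real m + real q - ?s) / 2}"
    unfolding largest_eigenvalue_def by (rule arg_cong)
  moreover have "?s \<ge> 0" by simp
  then have "Max {(real m + real q + ?s) / 2, (real m + real q - ?s) / 2} = (real m + real q + ?s) / 2"
    by (intro Max_eqI) auto
  ultimately show ?thesis by (rule trans)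
qed

theorem theorem1p2:
  fixes m n p q :: nat
    and N :: "int mat"
    and f :: "complex \<times> complex \<Rightarrow> complex \<times> complex"
  assumes "m \<ge> 1" and "n \<ge> 1" and "p \<ge> 1" and "q \<ge> 1"
    and "N = mat_of_rows_list 2 [[int m, int n], [int p, int q]]"
    and "Determinant.det N > 0"
    and "f \<in> blaschke_products m n p q"
  shows "convergent (degree_growth (ratmap_of f))
    \<and> first_dyn_degree (ratmap_of f) = first_dyn_degree (ratmap_of (monomial_map m n p q))
    \<and> first_dyn_degree (ratmap_of f) = largest_eigenvalue N
    \<and> largest_eigenvalue N =
        (real m + real q + sqrt ((real m - real q)\<^sup>2 + 4 * real n * real p)) / 2"
proof -
  let ?c = "(real m + real q + sqrt ((real m - real q)\<^sup>2 + 4 * real n * real p)) / 2"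
  have f: "degree_growth (ratmap_of f) \<longlonglongrightarrow> ?c"
    using assms by (intro degree_growth_blaschke_product)
  have monomial: "degree_growth (ratmap_of (monomial_map m n p q)) \<longlonglongrightarrow> ?c"
    using assms by (intro degree_growth_blaschke_product monomial_map_is_blaschke_product)
  have "largest_eigenvalue N = ?c"
    using largest_eigenvalue_2x2 assms by simp
  then show ?thesis
    unfolding first_dyn_degree_def limI[OF f] limI[OF monomial] using convergentI[OF f] by simp
qed

end
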